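(* Let $\mathcal R$ be a semisimple based root datum and let $\mathcal B_{gm}$ be an orthonormal basis of $\mathcal Y_{gm}$ (determined up to signs of its elements). For $b\in\mathcal B_{gm}$ let $d_b\in\mathbb Q^\times$ be the constant such that $\mathrm{fdeg}(\mathrm{Ind}_D(b;\mathbf v))=d_bm_b(\mathbf v)$ for all $\mathbf v\in\mathcal Q_b^{reg}$. Then the basis vector $b\in\mathcal B_{gm}$ (i.e. its sign) can be chosen uniquely such that $d_b>0$. With this choice, for every connected component $C$ of $\mathcal Q_b^{reg}$, the sign $\epsilon(b,C)$ is equal to the sign of $m_b(\mathbf v)$ for $\mathbf v\in C$.
   Context: **Affine Hecke algebra.** $\mathcal R=(X,R_0,Y,R_0^\vee,F_0)$: based semisimple root datum ($R_0$ reduced, spanning $X\otimes\mathbb Q$; $F_0$ simple roots); $W_0=W(R_0)$ with longest element $w_0$; $W=W_0\ltimes X$ with its usual length function $l$; $S\subset W$ the set of affine simple reflections. $\Lambda$ is the complex Laurent polynomial ring in invertible indeterminates $v(\mathbf s)$, $\mathbf s\in S$, with $v(\mathbf s)=v(\mathbf s')$ iff $\mathbf s,\mathbf s'$ are $W$-conjugate; $v(\cdot)$ extends to all reflections in $W$; $v(w_0)$ is the product of $v(\mathbf s_i)$ over a reduced expression. $\mathcal Q$ is the real vector group of positive points ($\mathbf v(\mathbf s)>0$); $\mathbf v^\epsilon(\mathbf s)=\mathbf v(\mathbf s)^\epsilon$. $\mathcal H_\Lambda$ has $\Lambda$-basis $N_w$ ($w\in W$), $N_wN_{w'}=N_{ww'}$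 if $l(ww')=l(w)+l(w')$, $(N_{\mathbf s}-v(\mathbf s))(N_{\mathbf s}+v(\mathbf s)^{-1})=0$; $\mathcal H_{\mathbf v}$ is its specialization at $\mathbf v$, and $\mathcal H_{\mathbf v=1}=\mathbb C[W]$. The $\theta_x$ ($x\in X$) are determined by $\theta_{x+y}=\theta_x\theta_y$ and $\theta_x=N_x$ for dominant $x$; they span $\mathcal A\simeq\mathbb C[X]$; the center is $\mathcal A^{W_0}$. $T=\mathrm{Hom}(X,\mathbb C^\times)=T_uT_v$ (unitary and real positive parts). Central characters are $W_0$-orbits in $T$. **Elliptic characters.** $\overline{\mathcal R}_{\mathbb Z}(\mathcal H_{\mathbf v})$ is the image of the Grothendieck group of finite dimensional modules in the quotient of its complexification by the span of representations induced from the subalgebras generated by $\mathcal A$ and $N_{s_\alpha}$ ($\alpha\in P$), $P\subsetneq F_0$. At $\mathbf v=1$ this gives $\overline{\mathcal R}_{\mathbb Z}(W)$, with positive definite integral pairing $EP(U,V)=\sum_i(-1)^i\dim\mathrm{Ext}^i_W(U,V)$; "orthonormal" refers to $EP$. **Discrete series.** An irreducible $\mathcal H_{\mathbf v}$-module is a discrete series if $|x(t)|<1$ for all generalized $\mathcal A$-weights $t$ and all dominant $0\ne x\in X$. With the trace $\tau(N_w)=\delta_{w,e}$ and antilinear involution $N_w^*=N_{w^{-1}}$, $\mathrm{fdeg}(\pi)>0$ is the Plancherel mass of a discrete series $\pi$, extended linearly to virtual discrete series characters. **Scaling map.** For $\alpha\in R_0$ with $\alpha^\vee\in 2Y$ let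 $s_\alpha'\in W$ be the reflection $x\mapsto s_\alpha(x)+\alpha$, $P_\alpha=v(s_\alpha)v(s'_\alpha)$, $D_\alpha=v(s_\alpha)/v(s'_\alpha)$. Put $c_\alpha=\frac{1-v(s_\alpha)^{-2}\theta_{-\alpha}}{1-\theta_{-\alpha}}$ if $\alpha^\vee\notin2Y$ and $c_\alpha=\frac{(1+D_\alpha^{-1}\theta_{-\alpha})(1-P_\alpha^{-1}\theta_{-\alpha})}{1-\theta_{-2\alpha}}$ if $\alpha^\vee\in2Y$; define $\iota_\alpha$ ($\alpha\in F_0$) by $1+\iota_\alpha=(1+v(s_\alpha)N_{s_\alpha})(v(s_\alpha)^2c_\alpha)^{-1}$. For $\pi$ with central character $W_0t$, $t=sc\in T_uT_v$, let $U=W_0(t\exp B)$ with $B$ a small $W_0$-stable ball around $0$ in $\mathrm{Lie}(T)$, $\sigma_\epsilon(w(sc\exp\beta))=w(sc^\epsilon\exp(\epsilon\beta))$, and let $j_\epsilon:\mathcal H^{an}_{\mathbf v}(U)\to\mathcal H^{an}_{\mathbf v^\epsilon}(\sigma_\epsilon(U))$ ($0<\epsilon\le1$) be the isomorphism of analytic localizations (extension of scalars by $W_0$-invariant analytic functions) with $f\mapsto f\circ\sigma_\epsilon^{-1}$, $\iota_\alpha\mapsto\iota_\alpha$. With $\pi_{\mathbf v^\epsilon}=\pi\circ j_\epsilon^{-1}$, the operators $\pi_{\mathbf v^\epsilon}(N_w)$ converge for $\epsilon\to0$ and define a representation of $W$; this gives an isometry $\mathrm{sp}_{\mathbf v}:\overline{\mathcal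 R}_{\mathbb Z}(\mathcal H_{\mathbf v})\to\overline{\mathcal R}_{\mathbb Z}(W)$. **Massive lattice, Dirac induction.** $\mathcal Y_{gm}\subset\overline{\mathcal R}_{\mathbb Z}(W)$ is generated by all $\mathrm{sp}_{\mathbf v}(\overline\pi)$, $\mathbf v\in\mathcal Q$, $\pi$ a discrete series of $\mathcal H_{\mathbf v}$. For $b\in\mathcal Y_{gm}$ of norm $1$, $\mathcal Q_b^{reg}$ is the set of $\mathbf v\in\mathcal Q$ for which $\mathrm{sp}_{\mathbf v}(\overline\pi)=\pm b$ for some irreducible discrete series $\pi$ of $\mathcal H_{\mathbf v}$. For $\mathbf v\in\mathcal Q_b^{reg}$, $\mathrm{Ind}_D(b;\mathbf v)$ is the unique virtual discrete series character of $\mathcal H_{\mathbf v}$ with image $b$ under $\mathrm{sp}_{\mathbf v}$; $\epsilon(b;\mathbf v)\in\{\pm1\}$ is the sign such that $\epsilon(b;\mathbf v)\mathrm{Ind}_D(b;\mathbf v)$ is an irreducible discrete series character; it is constant on each component $C$ of $\mathcal Q_b^{reg}$, with value $\epsilon(b,C)$. **The function $m_b$.** Let $R_1=\{\alpha\in R_0\mid\alpha^\vee\notin2Y\}\cup\{2\alpha\mid\alpha\in R_0,\alpha^\vee\in2Y\}$. For $r\in\mathrm{Hom}(X,\Lambda^\times)$ let $$m_{W_0r}=v(w_0)^{-2}\frac{\prod'_{\alpha\in R_1}(\alpha(r)^{-1}-1)}{\prod'_{\alpha\in R_0,\alpha^\vee\notin2Y}(v(s_\alpha)^{-2}\alpha(r)^{-1}-1)\prod'_{\alpha\in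 R_0,\alpha^\vee\in2Y}(D_\alpha^{-1}\alpha(r)^{-1}+1)\prod'_{\alpha\in R_0,\alpha^\vee\in2Y}(P_\alpha^{-1}\alpha(r)^{-1}-1)}$$ (identically zero factors omitted). $r$ is a generic residual point if the number of omitted denominator factors minus omitted numerator factors is $\mathrm{rank}\,X$; then $m_{W_0r}$ is regular on $\mathcal Q$. $W_0r_b$ is the unique orbit of generic residual points such that $\mathrm{Ind}_D(b;\mathbf v)$ has central character $W_0r_b(\mathbf v)$ for all $\mathbf v\in\mathcal Q_b^{reg}$, and $m_b:=m_{W_0r_b}$; $\mathcal Q_b^{reg}=\{\mathbf v\in\mathcal Q\mid m_b(\mathbf v)\ne0\}$. *)

theory Defs
  imports "HOL-Analysis.Analysis" "HOL-Library.Poly_Mapping" "Jordan_Normal_Form.Matrix"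
begin

section \<open>Formal linear combinations\<close>

abbreviation coef :: "('a \<Rightarrow>\<^sub>0 'b::zero) \<Rightarrow> 'a \<Rightarrow> 'b" where
  "coef \<equiv> Poly_Mapping.lookup"

abbreviation supp :: "('a \<Rightarrow>\<^sub>0 'b::zero) \<Rightarrow> 'a set" where
  "supp \<equiv> Poly_Mapping.keys"

abbreviation sng :: "'a \<Rightarrow> 'b \<Rightarrow> 'a \<Rightarrow>\<^sub>0 'b::zero" where
  "sng \<equiv> Poly_Mapping.single"

definition scl :: "complex \<Rightarrow> ('a \<Rightarrow>\<^sub>0 complex) \<Rightarrow> ('a \<Rightarrow>\<^sub>0 complex)" where
  "scl c x = Poly_Mapping.map ((*) c) x"

inductive_set cspan :: "('a \<Rightarrow>\<^sub>0 complex) set \<Rightarrow> ('a \<Rightarrow>\<^sub>0 complex) set"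
  for S :: "('a \<Rightarrow>\<^sub>0 complex) set" where
  zero: "0 \<in> cspan S"
| step: "x \<in> cspan S \<Longrightarrow> y \<in> S \<Longrightarrow> x + scl c y \<in> cspan S"

definition int_combs :: "'a set \<Rightarrow> ('a \<Rightarrow>\<^sub>0 complex) set" where
  "int_combs P = {x. supp x \<subseteq> P \<and> (\<forall>p. coef x p \<in> \<int>)}"

definition zmul :: "int \<Rightarrow> 'x::ab_group_add \<Rightarrow> 'x" where
  "zmul n x = (if 0 \<le> n then (\<Sum>i<nat n. x) else - (\<Sum>i<nat (- n). x))"


section \<open>Root data and the extended affine Weyl group\<close>

text \<open>\<open>X\<close> and \<open>Y\<close> are the types \<^typ>\<open>'x\<close> and \<^typ>\<open>'y\<close>; the field \<open>coroot\<close> is only relevant on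
  \<open>roots\<close>, where it is the bijection from roots to coroots.\<close>

record ('x, 'y) root_datum =
  pairing :: "'x \<Rightarrow> 'y \<Rightarrow> int"
  roots :: "'x set"
  coroot :: "'x \<Rightarrow> 'y"
  simple :: "'x set"

definition is_zbasis :: "'x::ab_group_add set \<Rightarrow> bool" where
  "is_zbasis E \<longleftrightarrow> finite E \<and>
     (\<forall>x. \<exists>!c :: 'x \<Rightarrow> int. (\<forall>e. e \<notin> E \<longrightarrow> c e = 0) \<and> x = (\<Sum>e\<in>E. zmul (c e) e))"

definition refl :: "('x::ab_group_add, 'y) root_datum \<Rightarrow> 'x \<Rightarrow> 'x \<Rightarrow> 'x" where
  "refl R \<alpha> x = x - zmul (pairing R x (coroot R \<alpha>)) \<alpha>"

definition corefl :: "('x, 'y::ab_group_add) root_datum \<Rightarrow> 'x \<Rightarrow> 'y \<Rightarrow> 'y" where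
  "corefl R \<alpha> y = y - zmul (pairing R \<alpha> y) (coroot R \<alpha>)"

definition positive_root :: "('x::ab_group_add, 'y) root_datum \<Rightarrow> 'x \<Rightarrow> bool" where
  "positive_root R \<alpha> \<longleftrightarrow> \<alpha> \<in> roots R \<and>
     (\<exists>c :: 'x \<Rightarrow> int. (\<forall>\<beta>\<in>simple R. 0 \<le> c \<beta>) \<and> \<alpha> = (\<Sum>\<beta>\<in>simple R. zmul (c \<beta>) \<beta>))"

definition semisimple_based_root_datum ::
    "('x::ab_group_add, 'y::ab_group_add) root_datum \<Rightarrow> bool" where
  "semisimple_based_root_datum R \<longleftrightarrow>
     (\<exists>E :: 'x set. is_zbasis E) \<and>
     (\<forall>x x' y. pairing R (x + x') y = pairing R x y + pairing R x' y) \<and>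
     (\<forall>x y y'. pairing R x (y + y') = pairing R x y + pairing R x y') \<and>
     (\<forall>f :: 'y \<Rightarrow> int. (\<forall>y y'. f (y + y') = f y + f y') \<longrightarrow> (\<exists>!x. \<forall>y. f y = pairing R x y)) \<and>
     (\<forall>f :: 'x \<Rightarrow> int. (\<forall>x x'. f (x + x') = f x + f x') \<longrightarrow> (\<exists>!y. \<forall>x. f x = pairing R x y)) \<and>
     finite (roots R) \<and> inj_on (coroot R) (roots R) \<and>
     (\<forall>\<alpha>\<in>roots R. pairing R \<alpha> (coroot R \<alpha>) = 2 \<and>
        refl R \<alpha> ` roots R = roots R \<and>
        corefl R \<alpha> ` coroot R ` roots R = coroot R ` roots R \<and>
        \<alpha> + \<alpha> \<notin> roots R) \<and>
     simple R \<subseteq> roots R \<and>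
     (\<forall>c :: 'x \<Rightarrow> int. (\<Sum>\<beta>\<in>simple R. zmul (c \<beta>) \<beta>) = 0 \<longrightarrow> (\<forall>\<beta>\<in>simple R. c \<beta> = 0)) \<and>
     (\<forall>\<alpha>\<in>roots R. positive_root R \<alpha> \<or> positive_root R (- \<alpha>)) \<and>
     (\<forall>x. \<exists>n>0. \<exists>c :: 'x \<Rightarrow> int. zmul n x = (\<Sum>\<alpha>\<in>roots R. zmul (c \<alpha>) \<alpha>))"

definition lattice_basis :: "('x::ab_group_add, 'y) root_datum \<Rightarrow> 'x set" where
  "lattice_basis R = (SOME E. is_zbasis E)"

definition rank :: "('x::ab_group_add, 'y) root_datum \<Rightarrow> nat" where
  "rank R = card (lattice_basis R)"

inductive_set W\<^sub>0 :: "('x::ab_group_add, 'y) root_datum \<Rightarrow> ('x \<Rightarrow> 'x) set"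
  for R :: "('x, 'y) root_datum" where
  one: "id \<in> W\<^sub>0 R"
| mult: "w \<in> W\<^sub>0 R \<Longrightarrow> \<alpha> \<in> roots R \<Longrightarrow> refl R \<alpha> \<circ> w \<in> W\<^sub>0 R"

definition transl :: "'x::ab_group_add \<Rightarrow> 'x \<Rightarrow> 'x" where
  "transl x = (\<lambda>z. z + x)"

text \<open>\<open>W\<close> is realised by its faithful action on \<open>X\<close> by affine transformations, so that its
  product is composition and its unit is \<^term>\<open>id\<close>.\<close>

definition W :: "('x::ab_group_add, 'y) root_datum \<Rightarrow> ('x \<Rightarrow> 'x) set" where
  "W R = {transl x \<circ> w | x w. w \<in> W\<^sub>0 R}"

text \<open>Affine roots \<open>(\<alpha>\<^sup>\<or>, k)\<close> are integer valued functions on \<open>X\<close>. Up to replacing \<open>w\<close> by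
  its inverse, which has the same length, the length of \<open>w\<close> counts the positive affine
  roots made negative by \<open>w\<close>.\<close>

definition pos_affine_roots :: "('x::ab_group_add, 'y) root_datum \<Rightarrow> ('x \<Rightarrow> int) set" where
  "pos_affine_roots R = {(\<lambda>x. pairing R x (coroot R \<alpha>) + k) | \<alpha> k.
     \<alpha> \<in> roots R \<and> (0 < k \<or> k = 0 \<and> positive_root R \<alpha>)}"

definition len :: "('x::ab_group_add, 'y) root_datum \<Rightarrow> ('x \<Rightarrow> 'x) \<Rightarrow> nat" where
  "len R w = card {a \<in> pos_affine_roots R. (\<lambda>x. - a (w x)) \<in> pos_affine_roots R}"

definition dominant :: "('x, 'y) root_datum \<Rightarrow> 'x \<Rightarrow> bool" where
  "dominant R x \<longleftrightarrow> (\<forall>\<alpha>\<in>simple R. 0 \<le> pairing R x (coroot R \<alpha>))"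

definition refl' :: "('x::ab_group_add, 'y) root_datum \<Rightarrow> 'x \<Rightarrow> 'x \<Rightarrow> 'x" where
  "refl' R \<alpha> x = refl R \<alpha> x + \<alpha>"

text \<open>The simple affine roots are \<open>(\<alpha>\<^sup>\<or>, 0)\<close> with \<open>\<alpha>\<close> simple and \<open>(-\<beta>\<^sup>\<or>, 1)\<close> with \<open>\<beta>\<^sup>\<or>\<close>
  maximal in the dominance order of the coroots.\<close>

definition maximal_coroot :: "('x, 'y::ab_group_add) root_datum \<Rightarrow> 'x \<Rightarrow> bool" where
  "maximal_coroot R \<beta> \<longleftrightarrow> \<beta> \<in> roots R \<and>
     (\<forall>\<gamma>\<in>roots R. (\<exists>c :: 'x \<Rightarrow> int. (\<forall>\<alpha>\<in>simple R. 0 \<le> c \<alpha>) \<and>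
        coroot R \<gamma> = coroot R \<beta> + (\<Sum>\<alpha>\<in>simple R. zmul (c \<alpha>) (coroot R \<alpha>))) \<longrightarrow> \<gamma> = \<beta>)"

definition simple_refls ::
    "('x::ab_group_add, 'y::ab_group_add) root_datum \<Rightarrow> ('x \<Rightarrow> 'x) set" where
  "simple_refls R = refl R ` simple R \<union> refl' R ` {\<beta>. maximal_coroot R \<beta>}"

definition conj_class :: "('x::ab_group_add, 'y) root_datum \<Rightarrow> ('x \<Rightarrow> 'x) \<Rightarrow> ('x \<Rightarrow> 'x) set" where
  "conj_class R s = {w \<circ> s \<circ> inv_into UNIV w | w. w \<in> W R}"

definition reflections ::
    "('x::ab_group_add, 'y::ab_group_add) root_datum \<Rightarrow> ('x \<Rightarrow> 'x) set" where
  "reflections R = (\<Union>s\<in>simple_refls R. conj_class R s)"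

definition w\<^sub>0 :: "('x::ab_group_add, 'y) root_datum \<Rightarrow> 'x \<Rightarrow> 'x" where
  "w\<^sub>0 R = (THE w. w \<in> W\<^sub>0 R \<and> (\<forall>w'\<in>W\<^sub>0 R. len R w' \<le> len R w))"

definition reduced_w\<^sub>0 :: "('x::ab_group_add, 'y) root_datum \<Rightarrow> ('x \<Rightarrow> 'x) list" where
  "reduced_w\<^sub>0 R = (SOME ss. set ss \<subseteq> refl R ` simple R \<and> foldr (\<circ>) ss id = w\<^sub>0 R \<and>
     length ss = len R (w\<^sub>0 R))"

definition even_coroot :: "('x, 'y::ab_group_add) root_datum \<Rightarrow> 'x \<Rightarrow> bool" where
  "even_coroot R \<alpha> \<longleftrightarrow> (\<exists>y. coroot R \<alpha> = y + y)"


section \<open>The parameter space and the Hecke algebra\<close>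

text \<open>A point of \<open>\<Q>\<close> is a positive conjugation invariant function on the reflections,
  extended by \<open>1\<close>; the product topology on functions induces on it the topology of the
  vector group \<open>(\<real>\<^sub>>\<^sub>0)\<^bsup>S/\<sim>\<^esup>\<close>.\<close>

type_synonym 'x param = "('x \<Rightarrow> 'x) \<Rightarrow> real"

definition param_space ::
    "('x::ab_group_add, 'y::ab_group_add) root_datum \<Rightarrow> 'x param set" where
  "param_space R = {v. (\<forall>s\<in>reflections R. 0 < v s) \<and>
     (\<forall>s\<in>reflections R. \<forall>w\<in>W R. v (w \<circ> s \<circ> inv_into UNIV w) = v s) \<and>
     (\<forall>s. s \<notin> reflections R \<longrightarrow> v s = 1)}"

definition vpow :: "'x param \<Rightarrow> real \<Rightarrow> 'x param" where
  "vpow v \<epsilon> = (\<lambda>s. v s powr \<epsilon>)"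

definition v_one :: "'x param" where
  "v_one = (\<lambda>_. 1)"

type_synonym 'x hecke = "('x \<Rightarrow> 'x) \<Rightarrow>\<^sub>0 complex"

definition N :: "('x \<Rightarrow> 'x) \<Rightarrow> 'x hecke" where
  "N w = sng w 1"

definition hecke_carrier :: "('x::ab_group_add, 'y) root_datum \<Rightarrow> 'x hecke set" where
  "hecke_carrier R = {h. supp h \<subseteq> W R}"

text \<open>The product of \<open>\<H>\<^sub>v\<close>, characterised by its defining relations (and set to \<open>0\<close> outside
  the carrier).\<close>

definition hecke_mult ::
    "('x::ab_group_add, 'y::ab_group_add) root_datum \<Rightarrow> 'x param \<Rightarrow> 'x hecke \<Rightarrow> 'x hecke \<Rightarrow> 'x hecke"
  where
  "hecke_mult R v = (THE m.
     (\<forall>a\<in>hecke_carrier R. \<forall>b\<in>hecke_carrier R. \<forall>c\<in>hecke_carrier R. \<forall>z.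
        m a b \<in> hecke_carrier R \<and>
        m (a + b) c = m a c + m b c \<and> m a (b + c) = m a b + m a c \<and>
        m (scl z a) b = scl z (m a b) \<and> m a (scl z b) = scl z (m a b) \<and>
        m (m a b) c = m a (m b c)) \<and>
     (\<forall>w\<in>W R. \<forall>w'\<in>W R. len R (w \<circ> w') = len R w + len R w' \<longrightarrow> m (N w) (N w') = N (w \<circ> w')) \<and>
     (\<forall>s\<in>simple_refls R.
        m (N s - scl (of_real (v s)) (N id)) (N s + scl (of_real (inverse (v s))) (N id)) = 0) \<and>
     (\<forall>a b. a \<notin> hecke_carrier R \<or> b \<notin> hecke_carrier R \<longrightarrow> m a b = 0))"

definition theta ::
    "('x::ab_group_add, 'y::ab_group_add) root_datum \<Rightarrow> 'x param \<Rightarrow> 'x \<Rightarrow> 'x hecke" where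
  "theta R v = (THE \<theta>. (\<forall>x. \<theta> x \<in> hecke_carrier R) \<and>
     (\<forall>x y. \<theta> (x + y) = hecke_mult R v (\<theta> x) (\<theta> y)) \<and>
     (\<forall>x. dominant R x \<longrightarrow> \<theta> x = N (transl x)))"

text \<open>The group algebra \<open>\<complex>[X]\<close> is \<^typ>\<open>'x \<Rightarrow>\<^sub>0 complex\<close>; \<open>theta_alg\<close> is its isomorphism with
  \<open>\<A>\<close>.\<close>

definition theta_alg ::
    "('x::ab_group_add, 'y::ab_group_add) root_datum \<Rightarrow> 'x param \<Rightarrow> ('x \<Rightarrow>\<^sub>0 complex) \<Rightarrow> 'x hecke"
  where
  "theta_alg R v a = (\<Sum>x\<in>supp a. scl (coef a x) (theta R v x))"

definition W0_invariant :: "('x::ab_group_add, 'y) root_datum \<Rightarrow> ('x \<Rightarrow>\<^sub>0 complex) \<Rightarrow> bool" where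
  "W0_invariant R a \<longleftrightarrow> (\<forall>w\<in>W\<^sub>0 R. \<forall>x. coef a (w x) = coef a x)"

type_synonym 'x torus_point = "'x \<Rightarrow> complex"

definition torus :: "'x::ab_group_add torus_point set" where
  "torus = {t. (\<forall>x y. t (x + y) = t x * t y) \<and> (\<forall>x. t x \<noteq> 0)}"

definition eval_at :: "'x torus_point \<Rightarrow> ('x \<Rightarrow>\<^sub>0 complex) \<Rightarrow> complex" where
  "eval_at t a = (\<Sum>x\<in>supp a. coef a x * t x)"

inductive_set parabolic_subalgebra ::
    "('x::ab_group_add, 'y::ab_group_add) root_datum \<Rightarrow> 'x param \<Rightarrow> 'x set \<Rightarrow> 'x hecke set"
  for R :: "('x, 'y) root_datum" and v :: "'x param" and P :: "'x set" where
  theta: "theta R v x \<in> parabolic_subalgebra R v P"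
| refl: "\<alpha> \<in> P \<Longrightarrow> N (refl R \<alpha>) \<in> parabolic_subalgebra R v P"
| add: "a \<in> parabolic_subalgebra R v P \<Longrightarrow> b \<in> parabolic_subalgebra R v P \<Longrightarrow>
    a + b \<in> parabolic_subalgebra R v P"
| scale: "a \<in> parabolic_subalgebra R v P \<Longrightarrow> scl z a \<in> parabolic_subalgebra R v P"
| mult: "a \<in> parabolic_subalgebra R v P \<Longrightarrow> b \<in> parabolic_subalgebra R v P \<Longrightarrow>
    hecke_mult R v a b \<in> parabolic_subalgebra R v P"


section \<open>Finite dimensional modules\<close>

text \<open>Modules over a subalgebra \<open>A\<close> of \<open>\<H>\<^sub>v\<close> are matrix representations; values outside \<open>A\<close> are
  irrelevant.\<close>

type_synonym 'x hrep = "'x hecke \<Rightarrow> complex mat"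

definition rdim :: "'x hrep \<Rightarrow> nat" where
  "rdim \<rho> = dim_row (\<rho> (N id))"

definition is_rep ::
    "('x::ab_group_add, 'y::ab_group_add) root_datum \<Rightarrow> 'x param \<Rightarrow> 'x hecke set \<Rightarrow> 'x hrep \<Rightarrow> bool"
  where
  "is_rep R v A \<rho> \<longleftrightarrow>
     \<rho> (N id) = 1\<^sub>m (rdim \<rho>) \<and>
     (\<forall>a\<in>A. \<rho> a \<in> carrier_mat (rdim \<rho>) (rdim \<rho>)) \<and>
     (\<forall>a\<in>A. \<forall>b\<in>A. \<rho> (a + b) = \<rho> a + \<rho> b \<and> \<rho> (hecke_mult R v a b) = \<rho> a * \<rho> b) \<and>
     (\<forall>a\<in>A. \<forall>z. \<rho> (scl z a) = z \<cdot>\<^sub>m \<rho> a)"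

definition hmodule ::
    "('x::ab_group_add, 'y::ab_group_add) root_datum \<Rightarrow> 'x param \<Rightarrow> 'x hrep \<Rightarrow> bool" where
  "hmodule R v \<rho> \<longleftrightarrow> is_rep R v (hecke_carrier R) \<rho>"

definition intertwiner :: "'x hecke set \<Rightarrow> 'x hrep \<Rightarrow> 'x hrep \<Rightarrow> complex mat \<Rightarrow> bool" where
  "intertwiner A \<rho> \<sigma> F \<longleftrightarrow>
     F \<in> carrier_mat (rdim \<sigma>) (rdim \<rho>) \<and> (\<forall>a\<in>A. F * \<rho> a = \<sigma> a * F)"

definition short_exact ::
    "('x::ab_group_add, 'y) root_datum \<Rightarrow> 'x hrep \<Rightarrow> 'x hrep \<Rightarrow> 'x hrep \<Rightarrow> bool" where
  "short_exact R \<rho>' \<rho> \<rho>'' \<longleftrightarrow> (\<exists>i p.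
     intertwiner (hecke_carrier R) \<rho>' \<rho> i \<and> intertwiner (hecke_carrier R) \<rho> \<rho>'' p \<and>
     (\<forall>u\<in>carrier_vec (rdim \<rho>'). i *\<^sub>v u = 0\<^sub>v (rdim \<rho>) \<longrightarrow> u = 0\<^sub>v (rdim \<rho>')) \<and>
     (\<forall>u\<in>carrier_vec (rdim \<rho>''). \<exists>x\<in>carrier_vec (rdim \<rho>). p *\<^sub>v x = u) \<and>
     (\<forall>x\<in>carrier_vec (rdim \<rho>).
        p *\<^sub>v x = 0\<^sub>v (rdim \<rho>'') \<longleftrightarrow> (\<exists>u\<in>carrier_vec (rdim \<rho>'). x = i *\<^sub>v u)))"

text \<open>\<open>\<rho>\<close> is induced from \<open>\<sigma>\<close>, by the universal property of \<open>\<H>\<^sub>v \<otimes>\<^bsub>\<H>\<^sup>P\<^esub> \<sigma>\<close>; as this module is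
  finite dimensional, testing against finite dimensional modules determines it.\<close>

definition induced_from ::
    "('x::ab_group_add, 'y::ab_group_add) root_datum \<Rightarrow> 'x param \<Rightarrow> 'x set \<Rightarrow> 'x hrep \<Rightarrow> 'x hrep \<Rightarrow> bool"
  where
  "induced_from R v P \<sigma> \<rho> \<longleftrightarrow> (\<exists>J. intertwiner (parabolic_subalgebra R v P) \<sigma> \<rho> J \<and>
     (\<forall>\<mu> F. hmodule R v \<mu> \<longrightarrow> intertwiner (parabolic_subalgebra R v P) \<sigma> \<mu> F \<longrightarrow>
        (\<exists>!G. intertwiner (hecke_carrier R) \<rho> \<mu> G \<and> G * J = F)))"

definition irreducible_rep ::
    "('x::ab_group_add, 'y::ab_group_add) root_datum \<Rightarrow> 'x param \<Rightarrow> 'x hrep \<Rightarrow> bool" where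
  "irreducible_rep R v \<rho> \<longleftrightarrow> hmodule R v \<rho> \<and> 0 < rdim \<rho> \<and>
     (\<forall>V \<subseteq> carrier_vec (rdim \<rho>).
        0\<^sub>v (rdim \<rho>) \<in> V \<and> (\<forall>x\<in>V. \<forall>y\<in>V. x + y \<in> V) \<and> (\<forall>z. \<forall>x\<in>V. z \<cdot>\<^sub>v x \<in> V) \<and>
        (\<forall>h\<in>hecke_carrier R. \<forall>x\<in>V. \<rho> h *\<^sub>v x \<in> V) \<longrightarrow>
        V = {0\<^sub>v (rdim \<rho>)} \<or> V = carrier_vec (rdim \<rho>))"

definition has_central_character ::
    "('x::ab_group_add, 'y::ab_group_add) root_datum \<Rightarrow> 'x param \<Rightarrow> 'x hrep \<Rightarrow> 'x torus_point \<Rightarrow> bool"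
  where
  "has_central_character R v \<rho> t \<longleftrightarrow> t \<in> torus \<and>
     (\<forall>a. W0_invariant R a \<longrightarrow> \<rho> (theta_alg R v a) = eval_at t a \<cdot>\<^sub>m 1\<^sub>m (rdim \<rho>))"

definition generalized_weight ::
    "('x::ab_group_add, 'y::ab_group_add) root_datum \<Rightarrow> 'x param \<Rightarrow> 'x hrep \<Rightarrow> 'x torus_point \<Rightarrow> bool"
  where
  "generalized_weight R v \<rho> t \<longleftrightarrow> t \<in> torus \<and>
     (\<exists>u\<in>carrier_vec (rdim \<rho>). u \<noteq> 0\<^sub>v (rdim \<rho>) \<and>
        (\<forall>x. \<exists>k. ((\<rho> (theta R v x) - t x \<cdot>\<^sub>m 1\<^sub>m (rdim \<rho>)) ^\<^sub>m k) *\<^sub>v u = 0\<^sub>v (rdim \<rho>)))"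

definition discrete_series ::
    "('x::ab_group_add, 'y::ab_group_add) root_datum \<Rightarrow> 'x param \<Rightarrow> 'x hrep \<Rightarrow> bool" where
  "discrete_series R v \<rho> \<longleftrightarrow> irreducible_rep R v \<rho> \<and>
     (\<forall>t x. generalized_weight R v \<rho> t \<and> dominant R x \<and> x \<noteq> 0 \<longrightarrow> cmod (t x) < 1)"


section \<open>Elliptic quotient of the Grothendieck group\<close>

text \<open>The complexified Grothendieck group is the space of formal combinations of modules modulo
  the relations from short exact sequences. An element of \<open>\<R>\<^sub>\<int>(\<H>\<^sub>v)\<close> bar is a coset of the
  subspace \<open>ell_null\<close> that contains an integral combination of modules.\<close>

type_synonym 'x ell_elt = "('x hrep \<Rightarrow>\<^sub>0 complex) set"

definition ell_null ::
    "('x::ab_group_add, 'y::ab_group_add) root_datum \<Rightarrow> 'x param \<Rightarrow> ('x hrep \<Rightarrow>\<^sub>0 complex) set" where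
  "ell_null R v = cspan (
     {sng \<rho> 1 - sng \<rho>' 1 - sng \<rho>'' 1 | \<rho> \<rho>' \<rho>''.
        hmodule R v \<rho> \<and> hmodule R v \<rho>' \<and> hmodule R v \<rho>'' \<and> short_exact R \<rho>' \<rho> \<rho>''} \<union>
     {sng \<rho> 1 | \<rho> \<sigma> P. P \<subset> simple R \<and> is_rep R v (parabolic_subalgebra R v P) \<sigma> \<and>
        hmodule R v \<rho> \<and> induced_from R v P \<sigma> \<rho>})"

definition ell_class ::
    "('x::ab_group_add, 'y::ab_group_add) root_datum \<Rightarrow> 'x param \<Rightarrow> ('x hrep \<Rightarrow>\<^sub>0 complex) \<Rightarrow> 'x ell_elt"
  where
  "ell_class R v x = {y. y - x \<in> ell_null R v}"

definition ell_neg :: "'x ell_elt \<Rightarrow> 'x ell_elt" where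
  "ell_neg b = uminus ` b"

text \<open>\<open>Ext\<^sup>i\<^sub>W(U, V)\<close> is computed by the bar resolution: cochains are maps from \<open>W\<^sup>i\<close> to
  \<open>Hom(U, V)\<close>, given by their matrix entries and extended by \<open>0\<close>.\<close>

type_synonym 'x cochain = "('x \<Rightarrow> 'x) list \<Rightarrow> nat \<Rightarrow> nat \<Rightarrow> complex"

definition cochains ::
    "('x::ab_group_add, 'y) root_datum \<Rightarrow> 'x hrep \<Rightarrow> 'x hrep \<Rightarrow> nat \<Rightarrow> 'x cochain set" where
  "cochains R U V i = {\<phi>. \<forall>gs a b. \<not> (set gs \<subseteq> W R \<and> length gs = i \<and> a < rdim V \<and> b < rdim U) \<longrightarrow>
     \<phi> gs a b = 0}"

definition bar_diff ::
    "('x::ab_group_add, 'y) root_datum \<Rightarrow> 'x hrep \<Rightarrow> 'x hrep \<Rightarrow> nat \<Rightarrow> 'x cochain \<Rightarrow> 'x cochain" where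
  "bar_diff R U V i \<phi> = (\<lambda>gs a b.
     if set gs \<subseteq> W R \<and> length gs = Suc i \<and> a < rdim V \<and> b < rdim U then
       (\<Sum>k<rdim V. V (N (hd gs)) $$ (a, k) * \<phi> (tl gs) k b) +
       (\<Sum>k\<in>{1..i}. (-1) ^ k * \<phi> (take (k - 1) gs @ [gs ! (k - 1) \<circ> gs ! k] @ drop (k + 1) gs) a b) +
       (-1) ^ Suc i * (\<Sum>k<rdim U. \<phi> (butlast gs) a k * U (N (last gs)) $$ (k, b))
     else 0)"

definition cocycles ::
    "('x::ab_group_add, 'y) root_datum \<Rightarrow> 'x hrep \<Rightarrow> 'x hrep \<Rightarrow> nat \<Rightarrow> 'x cochain set" where
  "cocycles R U V i = {\<phi> \<in> cochains R U V i. bar_diff R U V i \<phi> = (\<lambda>_ _ _. 0)}"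

definition coboundaries ::
    "('x::ab_group_add, 'y) root_datum \<Rightarrow> 'x hrep \<Rightarrow> 'x hrep \<Rightarrow> nat \<Rightarrow> 'x cochain set" where
  "coboundaries R U V i = (case i of 0 \<Rightarrow> {\<lambda>_ _ _. 0} | Suc j \<Rightarrow> bar_diff R U V j ` cochains R U V j)"

definition ext_dim ::
    "('x::ab_group_add, 'y) root_datum \<Rightarrow> 'x hrep \<Rightarrow> 'x hrep \<Rightarrow> nat \<Rightarrow> nat" where
  "ext_dim R U V i = (THE n. \<exists>f :: nat \<Rightarrow> 'x cochain.
     (\<forall>j<n. f j \<in> cocycles R U V i) \<and>
     (\<forall>\<phi>\<in>cocycles R U V i. \<exists>!c :: nat \<Rightarrow> complex. (\<forall>j\<ge>n. c j = 0) \<and>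
        (\<lambda>gs a b. \<phi> gs a b - (\<Sum>j<n. c j * f j gs a b)) \<in> coboundaries R U V i))"

definition EP_mod :: "('x::ab_group_add, 'y) root_datum \<Rightarrow> 'x hrep \<Rightarrow> 'x hrep \<Rightarrow> complex" where
  "EP_mod R U V = suminf (\<lambda>i. (-1) ^ i * of_nat (ext_dim R U V i))"

definition EP_form ::
    "('x::ab_group_add, 'y) root_datum \<Rightarrow> ('x hrep \<Rightarrow>\<^sub>0 complex) \<Rightarrow> ('x hrep \<Rightarrow>\<^sub>0 complex) \<Rightarrow> complex" where
  "EP_form R x y = (\<Sum>U\<in>supp x. \<Sum>V\<in>supp y. coef x U * coef y V * EP_mod R U V)"

definition EP ::
    "('x::ab_group_add, 'y) root_datum \<Rightarrow> 'x ell_elt \<Rightarrow> 'x ell_elt \<Rightarrow> complex" where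
  "EP R b b' = (THE z. \<forall>x\<in>b. \<forall>y\<in>b'. EP_form R x y = z)"


section \<open>Analytic localization and the scaling map\<close>

text \<open>\<open>Lie(T) = Hom(X, \<complex>)\<close>, with balls for the \<open>W\<^sub>0\<close>-invariant Hermitian norm
  \<open>\<beta> \<mapsto> \<surd>(\<Sum>\<^sub>\<alpha> |\<beta>(\<alpha>)|\<^sup>2)\<close>, which is a norm since the roots span \<open>X \<otimes> \<rat>\<close>.\<close>

definition lie_ball :: "('x::ab_group_add, 'y) root_datum \<Rightarrow> real \<Rightarrow> ('x \<Rightarrow> complex) set" where
  "lie_ball R r = {\<beta>. (\<forall>x y. \<beta> (x + y) = \<beta> x + \<beta> y) \<and> (\<Sum>\<alpha>\<in>roots R. (cmod (\<beta> \<alpha>))\<^sup>2) < r\<^sup>2}"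

definition exp_translate :: "'x torus_point \<Rightarrow> ('x \<Rightarrow> complex) \<Rightarrow> 'x torus_point" where
  "exp_translate t \<beta> = (\<lambda>x. t x * exp (\<beta> x))"

definition nbhd ::
    "('x::ab_group_add, 'y) root_datum \<Rightarrow> 'x torus_point \<Rightarrow> real \<Rightarrow> 'x torus_point set" where
  "nbhd R t r = {exp_translate t \<beta> \<circ> w | \<beta> w. \<beta> \<in> lie_ball R r \<and> w \<in> W\<^sub>0 R}"

text \<open>With \<open>t = sc\<close>, \<open>s(x) = t(x) / |t(x)|\<close>, \<open>c(x) = |t(x)|\<close>, the point \<open>sc\<^sup>\<epsilon>\<close>.\<close>

definition scale_point :: "'x torus_point \<Rightarrow> real \<Rightarrow> 'x torus_point" where
  "scale_point t \<epsilon> = (\<lambda>x. sgn (t x) * of_real (cmod (t x) powr \<epsilon>))"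

definition sigma ::
    "('x::ab_group_add, 'y) root_datum \<Rightarrow> 'x torus_point \<Rightarrow> real \<Rightarrow> real \<Rightarrow> 'x torus_point \<Rightarrow> 'x torus_point"
  where
  "sigma R t r \<epsilon> u = (THE u'. \<exists>\<beta>\<in>lie_ball R r. \<exists>w\<in>W\<^sub>0 R. u = exp_translate t \<beta> \<circ> w \<and>
     u' = exp_translate (scale_point t \<epsilon>) (\<lambda>x. of_real \<epsilon> * \<beta> x) \<circ> w)"

text \<open>Convergent power series expansion at \<open>u\<close> in the coordinates \<open>\<beta>(e)\<close>, with \<open>e\<close> running over a
  basis of \<open>X\<close>.\<close>

definition analytic_near ::
    "('x::ab_group_add, 'y) root_datum \<Rightarrow> ('x torus_point \<Rightarrow> complex) \<Rightarrow> 'x torus_point \<Rightarrow> bool" where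
  "analytic_near R f u \<longleftrightarrow> (\<exists>\<delta>>0. \<exists>a :: ('x \<Rightarrow> nat) \<Rightarrow> complex. \<forall>\<beta>\<in>lie_ball R \<delta>.
     ((\<lambda>k. a k * (\<Prod>e\<in>lattice_basis R. \<beta> e ^ k e)) has_sum f (exp_translate u \<beta>))
       (lattice_basis R \<rightarrow>\<^sub>E UNIV))"

text \<open>The ring \<open>C\<^bsup>an\<^esup>(U)\<^bsup>W\<^sub>0\<^esup>\<close>; functions on \<open>U\<close> are extended by \<open>0\<close>.\<close>

definition inv_analytic ::
    "('x::ab_group_add, 'y) root_datum \<Rightarrow> 'x torus_point set \<Rightarrow> ('x torus_point \<Rightarrow> complex) set" where
  "inv_analytic R U = {f. (\<forall>t. t \<notin> U \<longrightarrow> f t = 0) \<and> (\<forall>u\<in>U. analytic_near R f u) \<and>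
     (\<forall>w\<in>W\<^sub>0 R. \<forall>t. f (t \<circ> w) = f t)}"

text \<open>The algebra \<open>\<H>\<^sub>v\<^bsup>an\<^esup>(U) = \<H>\<^sub>v \<otimes> C\<^bsup>an\<^esup>(U)\<^bsup>W\<^sub>0\<^esup>\<close> (tensor product over the center \<open>\<A>\<^bsup>W\<^sub>0\<^esup>\<close>), as
  the quotient of \<open>loc_carrier\<close>, the free vector space on pairs \<open>(h, f)\<close>, by the subspace \<open>loc_null\<close>.\<close>

type_synonym 'x loc = "('x hecke \<times> ('x torus_point \<Rightarrow> complex)) \<Rightarrow>\<^sub>0 complex"

definition loc_carrier ::
    "('x::ab_group_add, 'y) root_datum \<Rightarrow> 'x torus_point set \<Rightarrow> 'x loc set" where
  "loc_carrier R U = {x. supp x \<subseteq> hecke_carrier R \<times> inv_analytic R U}"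

definition loc_null ::
    "('x::ab_group_add, 'y::ab_group_add) root_datum \<Rightarrow> 'x param \<Rightarrow> 'x torus_point set \<Rightarrow> 'x loc set"
  where
  "loc_null R v U = cspan (
     {sng (h + h', f) 1 - sng (h, f) 1 - sng (h', f) 1 | h h' f.
        h \<in> hecke_carrier R \<and> h' \<in> hecke_carrier R \<and> f \<in> inv_analytic R U} \<union>
     {sng (h, \<lambda>t. f t + f' t) 1 - sng (h, f) 1 - sng (h, f') 1 | h f f'.
        h \<in> hecke_carrier R \<and> f \<in> inv_analytic R U \<and> f' \<in> inv_analytic R U} \<union>
     {sng (scl z h, f) 1 - sng (h, f) z | z h f. h \<in> hecke_carrier R \<and> f \<in> inv_analytic R U} \<union>
     {sng (h, \<lambda>t. z * f t) 1 - sng (h, f) z | z h f. h \<in> hecke_carrier R \<and> f \<in> inv_analytic R U} \<union>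
     {sng (hecke_mult R v h (theta_alg R v a), f) 1 - sng (h, \<lambda>t. eval_at t a * f t) 1 | h a f.
        h \<in> hecke_carrier R \<and> W0_invariant R a \<and> f \<in> inv_analytic R U})"

definition loc_mult ::
    "('x::ab_group_add, 'y::ab_group_add) root_datum \<Rightarrow> 'x param \<Rightarrow> 'x loc \<Rightarrow> 'x loc \<Rightarrow> 'x loc" where
  "loc_mult R v x y = (\<Sum>p\<in>supp x. \<Sum>q\<in>supp y.
     sng (hecke_mult R v (fst p) (fst q), \<lambda>t. snd p t * snd q t) (coef x p * coef y q))"

definition loc_embed :: "'x torus_point set \<Rightarrow> 'x hecke \<Rightarrow> 'x loc" where
  "loc_embed U h = sng (h, indicator U) 1"

text \<open>The image of an analytic function on \<open>U\<close>, not necessarily invariant, in the localization: since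
  \<open>C\<^bsup>an\<^esup>(U) = \<A> \<cdot> C\<^bsup>an\<^esup>(U)\<^bsup>W\<^sub>0\<^esup>\<close>, it can be written as \<open>\<Sum>\<^sub>i a\<^sub>i g\<^sub>i\<close>, and is represented by
  \<open>\<Sum>\<^sub>i a\<^sub>i \<otimes> g\<^sub>i\<close>.\<close>

definition represents_fun ::
    "('x::ab_group_add, 'y::ab_group_add) root_datum \<Rightarrow> 'x param \<Rightarrow> 'x torus_point set \<Rightarrow>
     'x loc \<Rightarrow> ('x torus_point \<Rightarrow> complex) \<Rightarrow> bool" where
  "represents_fun R v U y f \<longleftrightarrow>
     (\<exists>zs :: (('x \<Rightarrow>\<^sub>0 complex) \<times> ('x torus_point \<Rightarrow> complex)) list.
        snd ` set zs \<subseteq> inv_analytic R U \<and>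
        y = (\<Sum>(a, g)\<leftarrow>zs. sng (theta_alg R v a, g) 1) \<and>
        (\<forall>u\<in>U. f u = (\<Sum>(a, g)\<leftarrow>zs. eval_at u a * g u)))"

text \<open>Numerator and denominator of \<open>c\<^sub>\<alpha>\<close>, as functions on \<open>T\<close>.\<close>

definition c_num ::
    "('x::ab_group_add, 'y::ab_group_add) root_datum \<Rightarrow> 'x param \<Rightarrow> 'x \<Rightarrow> 'x torus_point \<Rightarrow> complex" where
  "c_num R v \<alpha> t =
     (if even_coroot R \<alpha> then
        (1 + of_real (inverse (v (refl R \<alpha>) / v (refl' R \<alpha>))) * t (- \<alpha>)) *
        (1 - of_real (inverse (v (refl R \<alpha>) * v (refl' R \<alpha>))) * t (- \<alpha>))
      else 1 - of_real (inverse ((v (refl R \<alpha>))\<^sup>2)) * t (- \<alpha>))"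

definition c_den ::
    "('x::ab_group_add, 'y::ab_group_add) root_datum \<Rightarrow> 'x \<Rightarrow> 'x torus_point \<Rightarrow> complex" where
  "c_den R \<alpha> t = (if even_coroot R \<alpha> then 1 - t (- (\<alpha> + \<alpha>)) else 1 - t (- \<alpha>))"

text \<open>\<open>j\<close> maps representatives to representatives and induces the isomorphism \<open>j\<^sub>\<epsilon>\<close> of the
  localizations. The condition \<open>\<iota>\<^sub>\<alpha> \<mapsto> \<iota>\<^sub>\<alpha>\<close> is the last one: with \<open>c\<^sub>\<alpha> = n/\<delta>\<close> at \<open>v\<close> and \<open>c\<^sub>\<alpha> = n'/\<delta>\<close> at
  \<open>v' = v\<^sup>\<epsilon>\<close>, it says \<open>j((1 + v N)(v\<^sup>2 n/\<delta>)\<^sup>-\<^sup>1) = (1 + v' N)(v'\<^sup>2 n'/\<delta>)\<^sup>-\<^sup>1\<close>; multiplying from the right by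
  \<open>(v\<^sup>2 n \<circ> \<sigma>\<^sub>\<epsilon>\<^sup>-\<^sup>1) v'\<^sup>2 n'\<close> gives
  \<open>j(1 + v N) (\<delta> \<circ> \<sigma>\<^sub>\<epsilon>\<^sup>-\<^sup>1) v'\<^sup>2 n' = (1 + v' N) \<delta> (v\<^sup>2 n \<circ> \<sigma>\<^sub>\<epsilon>\<^sup>-\<^sup>1)\<close>,
  an equation in the localization, which is torsion free over the analytic functions.\<close>

definition scaling_iso ::
    "('x::ab_group_add, 'y::ab_group_add) root_datum \<Rightarrow> 'x param \<Rightarrow> 'x torus_point \<Rightarrow> real \<Rightarrow> real \<Rightarrow>
     ('x loc \<Rightarrow> 'x loc) \<Rightarrow> bool" where
  "scaling_iso R v t r \<epsilon> j \<longleftrightarrow>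
     (let U = nbhd R t r; \<sigma> = sigma R t r \<epsilon>; U' = \<sigma> ` U; v' = vpow v \<epsilon>;
          eqv = (\<lambda>x y. x - y \<in> loc_null R v' U') in
      (\<forall>x\<in>loc_carrier R U. j x \<in> loc_carrier R U' \<and>
         (x \<in> loc_null R v U \<longleftrightarrow> j x \<in> loc_null R v' U') \<and>
         (\<forall>z. eqv (j (scl z x)) (scl z (j x))) \<and>
         (\<forall>y\<in>loc_carrier R U. eqv (j (x + y)) (j x + j y) \<and>
            eqv (j (loc_mult R v x y)) (loc_mult R v' (j x) (j y)))) \<and>
      (\<forall>y\<in>loc_carrier R U'. \<exists>x\<in>loc_carrier R U. eqv (j x) y) \<and>
      (\<forall>y f y' f'. represents_fun R v U y f \<and> represents_fun R v' U' y' f' \<and>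
         (\<forall>u\<in>U. f' (\<sigma> u) = f u) \<longrightarrow> eqv (j y) y') \<and>
      (\<forall>\<alpha>\<in>simple R. \<forall>y1 y2 y3 y4 f1 f4.
         represents_fun R v' U' y1 f1 \<and> (\<forall>u\<in>U. f1 (\<sigma> u) = c_den R \<alpha> u) \<and>
         represents_fun R v' U' y2 (\<lambda>u. of_real ((v' (refl R \<alpha>))\<^sup>2) * c_num R v' \<alpha> u) \<and>
         represents_fun R v' U' y3 (c_den R \<alpha>) \<and>
         represents_fun R v' U' y4 f4 \<and>
         (\<forall>u\<in>U. f4 (\<sigma> u) = of_real ((v (refl R \<alpha>))\<^sup>2) * c_num R v \<alpha> u) \<longrightarrow>
         eqv (loc_mult R v' (loc_mult R v'
                (j (loc_embed U (N id + scl (of_real (v (refl R \<alpha>))) (N (refl R \<alpha>))))) y1) y2)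
             (loc_mult R v' (loc_mult R v'
                (loc_embed U' (N id + scl (of_real (v' (refl R \<alpha>))) (N (refl R \<alpha>)))) y3) y4)))"

text \<open>The (unique) extension of \<open>\<pi>\<close> to the localization.\<close>

definition extends_rep ::
    "('x::ab_group_add, 'y::ab_group_add) root_datum \<Rightarrow> 'x param \<Rightarrow> 'x torus_point set \<Rightarrow> 'x hrep \<Rightarrow>
     ('x loc \<Rightarrow> complex mat) \<Rightarrow> bool" where
  "extends_rep R v U \<pi> \<Phi> \<longleftrightarrow>
     (\<forall>x\<in>loc_carrier R U. \<Phi> x \<in> carrier_mat (rdim \<pi>) (rdim \<pi>) \<and>
        (x \<in> loc_null R v U \<longrightarrow> \<Phi> x = 0\<^sub>m (rdim \<pi>) (rdim \<pi>)) \<and>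
        (\<forall>z. \<Phi> (scl z x) = z \<cdot>\<^sub>m \<Phi> x) \<and>
        (\<forall>y\<in>loc_carrier R U. \<Phi> (x + y) = \<Phi> x + \<Phi> y \<and> \<Phi> (loc_mult R v x y) = \<Phi> x * \<Phi> y)) \<and>
     (\<forall>h\<in>hecke_carrier R. \<Phi> (loc_embed U h) = \<pi> h)"

text \<open>\<open>\<rho> = \<pi> \<circ> j\<^sub>\<epsilon>\<^sup>-\<^sup>1\<close> on \<open>\<H>\<^bsub>v\<^sup>\<epsilon>\<^esub>\<close>.\<close>

definition scaled_rep ::
    "('x::ab_group_add, 'y::ab_group_add) root_datum \<Rightarrow> 'x param \<Rightarrow> 'x torus_point \<Rightarrow> real \<Rightarrow> real \<Rightarrow>
     'x hrep \<Rightarrow> 'x hrep \<Rightarrow> bool" where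
  "scaled_rep R v t r \<epsilon> \<pi> \<rho> \<longleftrightarrow> (\<exists>j \<Phi>. scaling_iso R v t r \<epsilon> j \<and> extends_rep R v (nbhd R t r) \<pi> \<Phi> \<and>
     (\<forall>h\<in>hecke_carrier R. \<forall>x\<in>loc_carrier R (nbhd R t r).
        j x - loc_embed (sigma R t r \<epsilon> ` nbhd R t r) h
          \<in> loc_null R (vpow v \<epsilon>) (sigma R t r \<epsilon> ` nbhd R t r) \<longrightarrow> \<rho> h = \<Phi> x))"

definition is_scaling_limit ::
    "('x::ab_group_add, 'y::ab_group_add) root_datum \<Rightarrow> 'x param \<Rightarrow> 'x hrep \<Rightarrow> 'x hrep \<Rightarrow> bool" where
  "is_scaling_limit R v \<pi> \<rho>\<^sub>0 \<longleftrightarrow> hmodule R v_one \<rho>\<^sub>0 \<and> rdim \<rho>\<^sub>0 = rdim \<pi> \<and>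
     (\<exists>t. has_central_character R v \<pi> t \<and>
        (\<forall>\<^sub>F r in at_right 0. \<exists>\<rho> :: real \<Rightarrow> 'x hrep.
           (\<forall>\<epsilon>\<in>{0<..1}. scaled_rep R v t r \<epsilon> \<pi> (\<rho> \<epsilon>)) \<and>
           (\<forall>w\<in>W R. \<forall>i<rdim \<pi>. \<forall>k<rdim \<pi>.
              ((\<lambda>\<epsilon>. \<rho> \<epsilon> (N w) $$ (i, k)) \<longlongrightarrow> \<rho>\<^sub>0 (N w) $$ (i, k)) (at_right 0))))"

definition scaling_limit ::
    "('x::ab_group_add, 'y::ab_group_add) root_datum \<Rightarrow> 'x param \<Rightarrow> 'x hrep \<Rightarrow> 'x hrep" where
  "scaling_limit R v \<pi> = (SOME \<rho>\<^sub>0. is_scaling_limit R v \<pi> \<rho>\<^sub>0)"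

text \<open>The graph of \<open>sp\<^sub>v\<close>: the additive map sending the class of an irreducible module to the class of
  its scaling limit.\<close>

definition sp ::
    "('x::ab_group_add, 'y::ab_group_add) root_datum \<Rightarrow> 'x param \<Rightarrow> 'x ell_elt \<Rightarrow> 'x ell_elt \<Rightarrow> bool" where
  "sp R v a b \<longleftrightarrow> (\<exists>x\<in>int_combs {\<pi>. irreducible_rep R v \<pi>}. a = ell_class R v x \<and>
     b = ell_class R v_one (\<Sum>\<pi>\<in>supp x. sng (scaling_limit R v \<pi>) (coef x \<pi>)))"


section \<open>The massive lattice and Dirac induction\<close>

text \<open>Elements of the subgroup, like its generators, are cosets of \<open>ell_null R v_one\<close>.\<close>

inductive_set subgroup_generated ::
    "('x::ab_group_add, 'y::ab_group_add) root_datum \<Rightarrow> 'x ell_elt set \<Rightarrow> 'x ell_elt set"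
  for R :: "('x, 'y) root_datum" and G :: "'x ell_elt set" where
  zero: "ell_null R v_one \<in> subgroup_generated R G"
| add: "a \<in> subgroup_generated R G \<Longrightarrow> g \<in> G \<Longrightarrow> {x + y | x y. x \<in> a \<and> y \<in> g} \<in> subgroup_generated R G"
| diff: "a \<in> subgroup_generated R G \<Longrightarrow> g \<in> G \<Longrightarrow> {x - y | x y. x \<in> a \<and> y \<in> g} \<in> subgroup_generated R G"

definition massive_lattice ::
    "('x::ab_group_add, 'y::ab_group_add) root_datum \<Rightarrow> 'x ell_elt set" where
  "massive_lattice R = subgroup_generated R
     {b. \<exists>v\<in>param_space R. \<exists>\<pi>. discrete_series R v \<pi> \<and> sp R v (ell_class R v (sng \<pi> 1)) b}"

definition orthonormal_basis ::
    "('x::ab_group_add, 'y::ab_group_add) root_datum \<Rightarrow> 'x ell_elt set \<Rightarrow> 'x ell_elt set \<Rightarrow> bool" where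
  "orthonormal_basis R L B \<longleftrightarrow> B \<subseteq> L \<and> subgroup_generated R B = L \<and>
     (\<forall>b\<in>B. \<forall>b'\<in>B. EP R b b' = (if b = b' then 1 else 0))"

definition Q_reg ::
    "('x::ab_group_add, 'y::ab_group_add) root_datum \<Rightarrow> 'x ell_elt \<Rightarrow> 'x param set" where
  "Q_reg R b = {v \<in> param_space R. \<exists>\<pi>. discrete_series R v \<pi> \<and>
     (sp R v (ell_class R v (sng \<pi> 1)) b \<or> sp R v (ell_class R v (sng \<pi> 1)) (ell_neg b))}"

text \<open>Virtual characters are trace functions \<open>w \<mapsto> tr \<pi>(N\<^sub>w)\<close>, extended by \<open>0\<close> outside \<open>W\<close>.\<close>

definition vchar ::
    "('x::ab_group_add, 'y) root_datum \<Rightarrow> ('x hrep \<Rightarrow>\<^sub>0 complex) \<Rightarrow> ('x \<Rightarrow> 'x) \<Rightarrow> complex" where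
  "vchar R x w = (if w \<in> W R then
     (\<Sum>\<pi>\<in>supp x. coef x \<pi> * (\<Sum>i<rdim \<pi>. \<pi> (N w) $$ (i, i))) else 0)"

definition virtual_ds ::
    "('x::ab_group_add, 'y::ab_group_add) root_datum \<Rightarrow> 'x param \<Rightarrow> (('x \<Rightarrow> 'x) \<Rightarrow> complex) set" where
  "virtual_ds R v = vchar R ` int_combs {\<pi>. discrete_series R v \<pi>}"

text \<open>\<open>\<xi> = Ind\<^sub>D(b; v)\<close>, i.e. \<open>\<xi>\<close> is the unique virtual discrete series character with image \<open>b\<close>.\<close>

definition is_dirac_induction ::
    "('x::ab_group_add, 'y::ab_group_add) root_datum \<Rightarrow> 'x ell_elt \<Rightarrow> 'x param \<Rightarrow>
     (('x \<Rightarrow> 'x) \<Rightarrow> complex) \<Rightarrow> bool" where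
  "is_dirac_induction R b v \<xi> \<longleftrightarrow>
     {vchar R x | x. x \<in> int_combs {\<pi>. discrete_series R v \<pi>} \<and> sp R v (ell_class R v x) b} = {\<xi>}"

definition is_dirac_sign ::
    "('x::ab_group_add, 'y::ab_group_add) root_datum \<Rightarrow> 'x ell_elt \<Rightarrow> 'x param \<Rightarrow> int \<Rightarrow> bool" where
  "is_dirac_sign R b v e \<longleftrightarrow> e \<in> {1, -1} \<and> (\<exists>\<xi>. is_dirac_induction R b v \<xi> \<and>
     (\<exists>\<pi>. discrete_series R v \<pi> \<and> (\<lambda>w. of_int e * \<xi> w) = vchar R (sng \<pi> 1)))"

text \<open>\<open>\<epsilon>(b, C)\<close>, the common value of \<open>\<epsilon>(b; v)\<close> for \<open>v \<in> C\<close>.\<close>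

definition dirac_sign ::
    "('x::ab_group_add, 'y::ab_group_add) root_datum \<Rightarrow> 'x ell_elt \<Rightarrow> 'x param set \<Rightarrow> int" where
  "dirac_sign R b C = (THE e. \<forall>v\<in>C. is_dirac_sign R b v e)"


section \<open>Formal degrees\<close>

text \<open>Characters of the irreducible modules that are unitarizable for \<open>N\<^sub>w\<^sup>* = N\<^bsub>w\<^sup>-\<^sup>1\<^esub>\<close>.\<close>

definition unitary_dual ::
    "('x::ab_group_add, 'y::ab_group_add) root_datum \<Rightarrow> 'x param \<Rightarrow> (('x \<Rightarrow> 'x) \<Rightarrow> complex) set" where
  "unitary_dual R v = {restrict (vchar R (sng \<rho> 1)) (W R) | \<rho>. irreducible_rep R v \<rho> \<and>
     (\<forall>w\<in>W R. \<rho> (N (inv_into UNIV w)) = map_mat cnj (transpose_mat (\<rho> (N w))))}"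

text \<open>The Plancherel measure decomposes the trace \<open>\<tau>(N\<^sub>w) = \<delta>\<^bsub>w,e\<^esub>\<close> as an integral of irreducible
  characters; irreducible modules are identified with their characters, and the Borel
  structure on the dual is generated by the functions \<open>\<xi> \<mapsto> \<xi>(N\<^sub>w)\<close>.\<close>

definition plancherel_measure ::
    "('x::ab_group_add, 'y::ab_group_add) root_datum \<Rightarrow> 'x param \<Rightarrow>
     (('x \<Rightarrow> 'x) \<Rightarrow> complex) measure \<Rightarrow> bool" where
  "plancherel_measure R v M \<longleftrightarrow> sets M = sets (\<Pi>\<^sub>M w\<in>W R. (borel :: complex measure)) \<and>
     (AE \<xi> in M. \<xi> \<in> unitary_dual R v) \<and>
     (\<forall>w\<in>W R. integrable M (\<lambda>\<xi>. \<xi> w) \<and> (\<integral>\<xi>. \<xi> w \<partial>M) = (if w = id then 1 else 0))"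

text \<open>The mass of a discrete series is an atom of the Plancherel measure, hence positive; the relation
  only holds for positive \<open>c\<close>.\<close>

definition has_plancherel_mass ::
    "('x::ab_group_add, 'y::ab_group_add) root_datum \<Rightarrow> 'x param \<Rightarrow> 'x hrep \<Rightarrow> real \<Rightarrow> bool" where
  "has_plancherel_mass R v \<pi> c \<longleftrightarrow> 0 < c \<and>
     (\<exists>M. plancherel_measure R v M \<and> c = measure M {restrict (vchar R (sng \<pi> 1)) (W R)})"

text \<open>\<open>fdeg(\<xi>) = c\<close> for a virtual discrete series character \<open>\<xi>\<close>: \<open>F\<close> is the linear extension of the
  Plancherel mass.\<close>

definition has_fdeg ::
    "('x::ab_group_add, 'y::ab_group_add) root_datum \<Rightarrow> 'x param \<Rightarrow> (('x \<Rightarrow> 'x) \<Rightarrow> complex) \<Rightarrow> real \<Rightarrow> bool"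
  where
  "has_fdeg R v \<xi> c \<longleftrightarrow> \<xi> \<in> virtual_ds R v \<and> (\<exists>F.
     (\<forall>\<psi>\<in>virtual_ds R v. \<forall>\<psi>'\<in>virtual_ds R v. F (\<lambda>w. \<psi> w + \<psi>' w) = F \<psi> + F \<psi>') \<and>
     (\<forall>\<pi>. discrete_series R v \<pi> \<longrightarrow> has_plancherel_mass R v \<pi> (F (vchar R (sng \<pi> 1)))) \<and>
     F \<xi> = c)"


section \<open>The rational function \<open>m\<^sub>b\<close>\<close>

text \<open>\<open>\<Lambda>\<close> consists of the Laurent polynomials whose indeterminates are the conjugacy classes of
  elements of \<open>S\<close>; a Laurent monomial is an integer valued function on the indeterminates.\<close>

type_synonym 'x laurent = "(('x \<Rightarrow> 'x) set \<Rightarrow>\<^sub>0 int) \<Rightarrow>\<^sub>0 complex"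

definition Lambda ::
    "('x::ab_group_add, 'y::ab_group_add) root_datum \<Rightarrow> 'x laurent set" where
  "Lambda R = {p. \<forall>k\<in>supp p. supp k \<subseteq> conj_class R ` simple_refls R}"

definition vmon ::
    "('x::ab_group_add, 'y) root_datum \<Rightarrow> ('x \<Rightarrow> 'x) \<Rightarrow> int \<Rightarrow> 'x laurent" where
  "vmon R s k = sng (sng (conj_class R s) k) 1"

definition eval_param :: "'x param \<Rightarrow> 'x laurent \<Rightarrow> complex" where
  "eval_param v p = (\<Sum>k\<in>supp p. coef p k * (\<Prod>c\<in>supp k. of_real (v (SOME s. s \<in> c)) powi coef k c))"

definition generic_points ::
    "('x::ab_group_add, 'y::ab_group_add) root_datum \<Rightarrow> ('x \<Rightarrow> 'x laurent) set" where
  "generic_points R = {r. (\<forall>x y. r (x + y) = r x * r y) \<and>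
     (\<forall>x. r x \<in> Lambda R \<and> (\<exists>q\<in>Lambda R. r x * q = 1))}"

definition R\<^sub>1 :: "('x::ab_group_add, 'y::ab_group_add) root_datum \<Rightarrow> 'x set" where
  "R\<^sub>1 R = {\<alpha> \<in> roots R. \<not> even_coroot R \<alpha>} \<union> {\<alpha> + \<alpha> | \<alpha>. \<alpha> \<in> roots R \<and> even_coroot R \<alpha>}"

definition num_factor :: "('x::ab_group_add \<Rightarrow> 'x laurent) \<Rightarrow> 'x \<Rightarrow> 'x laurent" where
  "num_factor r \<alpha> = r (- \<alpha>) - 1"

definition den_factor ::
    "('x::ab_group_add, 'y) root_datum \<Rightarrow> ('x \<Rightarrow> 'x laurent) \<Rightarrow> 'x \<Rightarrow> 'x laurent" where
  "den_factor R r \<alpha> = vmon R (refl R \<alpha>) (-2) * r (- \<alpha>) - 1"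

definition den_factor_D ::
    "('x::ab_group_add, 'y) root_datum \<Rightarrow> ('x \<Rightarrow> 'x laurent) \<Rightarrow> 'x \<Rightarrow> 'x laurent" where
  "den_factor_D R r \<alpha> = vmon R (refl R \<alpha>) (-1) * vmon R (refl' R \<alpha>) 1 * r (- \<alpha>) + 1"

definition den_factor_P ::
    "('x::ab_group_add, 'y) root_datum \<Rightarrow> ('x \<Rightarrow> 'x laurent) \<Rightarrow> 'x \<Rightarrow> 'x laurent" where
  "den_factor_P R r \<alpha> = vmon R (refl R \<alpha>) (-1) * vmon R (refl' R \<alpha>) (-1) * r (- \<alpha>) - 1"

definition generic_residual ::
    "('x::ab_group_add, 'y::ab_group_add) root_datum \<Rightarrow> ('x \<Rightarrow> 'x laurent) \<Rightarrow> bool" where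
  "generic_residual R r \<longleftrightarrow> r \<in> generic_points R \<and>
     int (card {\<alpha> \<in> roots R. \<not> even_coroot R \<alpha> \<and> den_factor R r \<alpha> = 0} +
          card {\<alpha> \<in> roots R. even_coroot R \<alpha> \<and> den_factor_D R r \<alpha> = 0} +
          card {\<alpha> \<in> roots R. even_coroot R \<alpha> \<and> den_factor_P R r \<alpha> = 0}) -
     int (card {\<alpha> \<in> R\<^sub>1 R. num_factor r \<alpha> = 0}) = int (rank R)"

definition m_num ::
    "('x::ab_group_add, 'y::ab_group_add) root_datum \<Rightarrow> ('x \<Rightarrow> 'x laurent) \<Rightarrow> 'x laurent" where
  "m_num R r = prod_list (map (\<lambda>s. vmon R s (-2)) (reduced_w\<^sub>0 R)) *
     (\<Prod>\<alpha> | \<alpha> \<in> R\<^sub>1 R \<and> num_factor r \<alpha> \<noteq> 0. num_factor r \<alpha>)"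

definition m_den ::
    "('x::ab_group_add, 'y::ab_group_add) root_datum \<Rightarrow> ('x \<Rightarrow> 'x laurent) \<Rightarrow> 'x laurent" where
  "m_den R r =
     (\<Prod>\<alpha> | \<alpha> \<in> roots R \<and> \<not> even_coroot R \<alpha> \<and> den_factor R r \<alpha> \<noteq> 0. den_factor R r \<alpha>) *
     (\<Prod>\<alpha> | \<alpha> \<in> roots R \<and> even_coroot R \<alpha> \<and> den_factor_D R r \<alpha> \<noteq> 0. den_factor_D R r \<alpha>) *
     (\<Prod>\<alpha> | \<alpha> \<in> roots R \<and> even_coroot R \<alpha> \<and> den_factor_P R r \<alpha> \<noteq> 0. den_factor_P R r \<alpha>)"

text \<open>Value at \<open>v\<close> of the element \<open>m_num / m_den\<close> of the fraction field of \<open>\<Lambda>\<close>: common factors of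
  numerator and denominator may vanish at \<open>v\<close>, so the value is taken from any fraction \<open>p/q\<close>
  representing the same element with \<open>q(v) \<noteq> 0\<close>. It is \<open>0\<close> by convention if there is none.\<close>

definition m_value ::
    "('x::ab_group_add, 'y::ab_group_add) root_datum \<Rightarrow> ('x \<Rightarrow> 'x laurent) \<Rightarrow> 'x param \<Rightarrow> complex" where
  "m_value R r v =
     (if \<exists>p\<in>Lambda R. \<exists>q\<in>Lambda R. p * m_den R r = q * m_num R r \<and> eval_param v q \<noteq> 0
      then THE y. \<exists>p\<in>Lambda R. \<exists>q\<in>Lambda R. p * m_den R r = q * m_num R r \<and>
             eval_param v q \<noteq> 0 \<and> y = eval_param v p / eval_param v q
      else 0)"

definition virtual_central_character ::
    "('x::ab_group_add, 'y::ab_group_add) root_datum \<Rightarrow> 'x param \<Rightarrow> (('x \<Rightarrow> 'x) \<Rightarrow> complex) \<Rightarrow>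
     'x torus_point \<Rightarrow> bool" where
  "virtual_central_character R v \<xi> t \<longleftrightarrow> (\<exists>x\<in>int_combs {\<pi>. discrete_series R v \<pi>}.
     \<xi> = vchar R x \<and> (\<forall>\<pi>\<in>supp x. has_central_character R v \<pi> t))"

definition is_r\<^sub>b ::
    "('x::ab_group_add, 'y::ab_group_add) root_datum \<Rightarrow> 'x ell_elt \<Rightarrow> ('x \<Rightarrow> 'x laurent) \<Rightarrow> bool" where
  "is_r\<^sub>b R b r \<longleftrightarrow> generic_residual R r \<and>
     (\<forall>v\<in>Q_reg R b. \<exists>\<xi>. is_dirac_induction R b v \<xi> \<and>
        virtual_central_character R v \<xi> (\<lambda>x. eval_param v (r x)))"

text \<open>The points \<open>r\<^sub>b\<close> form a single \<open>W\<^sub>0\<close>-orbit; if they did not, the value would be \<open>0\<close> by convention.\<close>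

definition m\<^sub>b ::
    "('x::ab_group_add, 'y::ab_group_add) root_datum \<Rightarrow> 'x ell_elt \<Rightarrow> 'x param \<Rightarrow> complex" where
  "m\<^sub>b R b v =
     (if \<exists>r. {r'. is_r\<^sub>b R b r'} = {r \<circ> w | w. w \<in> W\<^sub>0 R} then m_value R (SOME r. is_r\<^sub>b R b r) v else 0)"

text \<open>\<open>fdeg(Ind\<^sub>D(b; v)) = d m\<^sub>b(v)\<close>, where both sides are understood to be defined.\<close>

definition is_degree_constant ::
    "('x::ab_group_add, 'y::ab_group_add) root_datum \<Rightarrow> 'x ell_elt \<Rightarrow> rat \<Rightarrow> bool" where
  "is_degree_constant R b d \<longleftrightarrow> d \<noteq> 0 \<and>
     (\<forall>v\<in>Q_reg R b. \<exists>\<xi> c. is_dirac_induction R b v \<xi> \<and> has_fdeg R v \<xi> c \<and>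
        complex_of_real c = of_rat d * m\<^sub>b R b v)"

definition d\<^sub>b ::
    "('x::ab_group_add, 'y::ab_group_add) root_datum \<Rightarrow> 'x ell_elt \<Rightarrow> rat" where
  "d\<^sub>b R b = (THE d. is_degree_constant R b d)"

end

theory Submission
  imports Defs "HOL-Computational_Algebra.Polynomial"
begin

text \<open>Replacing \<open>b\<close> by \<open>-b\<close> replaces \<open>Ind\<^sub>D(b; v)\<close> by its negative and changes neither \<open>r\<^sub>b\<close> nor
  \<open>m\<^sub>b\<close>, so it negates \<open>d\<^sub>b\<close>; hence exactly one of \<open>\<plusminus>b\<close> has a positive constant. Since discrete
  series have positive formal degree, \<open>\<epsilon>(b; v)\<close> is the sign of \<open>fdeg(Ind\<^sub>D(b; v)) = d\<^sub>b m\<^sub>b(v)\<close>, and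
  so the sign of \<open>m\<^sub>b(v)\<close> if \<open>d\<^sub>b > 0\<close>. In particular \<open>m\<^sub>b\<close> is real and has no zeros on \<open>\<Q>\<^sub>b\<^sup>r\<^sup>e\<^sup>g\<close>.
  It is continuous there, because \<open>\<Lambda>\<close> is an integral domain and the value of an element of its
  fraction field is therefore independent of the fraction; so the sign is constant on components.\<close>

section \<open>Laurent polynomials\<close>

text \<open>Only finitely many indeterminates occur in \<open>D\<close>. Numbering them turns
  exponents into integer polynomials, additively, and evaluation at an integer that is a root of
  none of the finitely many nonzero polynomials gives \<open>\<phi>\<close>.\<close>

lemma additive_int_nonzero_on_finite:
  fixes D :: "('c \<Rightarrow>\<^sub>0 int) set"
  assumes "finite D" and "0 \<notin> D"
  obtains \<phi> :: "('c \<Rightarrow>\<^sub>0 int) \<Rightarrow> int"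
  where "\<And>k l. \<phi> (k + l) = \<phi> k + \<phi> l" and "\<And>d. d \<in> D \<Longrightarrow> \<phi> d \<noteq> 0"
proof -
  define S where "S = (\<Union>d\<in>D. supp d)"
  have finS: "finite S" using assms(1) by (simp add: S_def)
  then obtain g :: "'c \<Rightarrow> nat" where g: "inj_on g S"
    using finite_imp_inj_to_nat_seg by metis
  define P where "P k = (\<Sum>c\<in>S. monom (coef k c) (g c))" for k :: "'c \<Rightarrow>\<^sub>0 int"
  have P_add: "P (k + l) = P k + P l" for k l
    by (simp add: P_def lookup_add add_monom [symmetric] sum.distrib)
  have P_nz: "P d \<noteq> 0" if "d \<in> D" for d
  proof -
    obtain c where c: "c \<in> supp d"
      using \<open>d \<in> D\<close> assms(2) by fastforce
    then have "c \<in> S" using that by (auto simp: S_def)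
    \<comment> \<open>As \<open>g\<close> is injective on \<open>S\<close>, no other indeterminate
      contributes to this coefficient.\<close>
    have "coeff (P d) (g c) = (\<Sum>c'\<in>S. if c' = c then coef d c else 0)"
      unfolding P_def coeff_sum coeff_monom using g \<open>c \<in> S\<close>
      by (intro sum.cong) (auto simp: inj_on_eq_iff)
    also have "\<dots> = coef d c" using finS \<open>c \<in> S\<close> by simp
    finally have "coeff (P d) (g c) \<noteq> 0" using c by (simp add: in_keys_iff)
    then show ?thesis by auto
  qed
  have "finite (\<Union>d\<in>D. {M. poly (P d) M = 0})"
    using assms(1) P_nz by (auto intro: poly_roots_finite)
  then obtain M where "M \<notin> (\<Union>d\<in>D. {M. poly (P d) M = 0})"
    using ex_new_if_finite infinite_UNIV_int by blast
  then show thesis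
    by (intro that [of "\<lambda>k. poly (P k) M"]) (auto simp: P_add)
qed

lemma poly_mapping_sum_monomials: "p = (\<Sum>k\<in>supp p. sng k (coef p k))"
  by (rule poly_mapping_eqI) (auto simp: lookup_sum lookup_single when_def in_keys_iff)

lemma poly_mapping_mult_expand:
  fixes p q :: "'k::comm_monoid_add \<Rightarrow>\<^sub>0 'b::comm_semiring_0"
  shows "p * q = (\<Sum>k\<in>supp p. \<Sum>l\<in>supp q. sng (k + l) (coef p k * coef q l))"
proof -
  have "p * q = (\<Sum>k\<in>supp p. sng k (coef p k)) * (\<Sum>l\<in>supp q. sng l (coef q l))"
    by (simp flip: poly_mapping_sum_monomials)
  then show ?thesis
    by (simp add: sum_product mult_single)
qed

text \<open>The library provides this only for linearly ordered exponents. An additive map to the integers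
  that is injective on both supports serves as a substitute for the order: the product of the leading
  terms does not cancel.\<close>

lemma laurent_no_zero_divisors:
  fixes p q :: "('c \<Rightarrow>\<^sub>0 int) \<Rightarrow>\<^sub>0 'b::{comm_semiring_0, semiring_no_zero_divisors}"
  assumes "p \<noteq> 0" and "q \<noteq> 0"
  shows "p * q \<noteq> 0"
proof -
  \<comment> \<open>For an additive map, not vanishing on these differences means being injective on
    each of the two supports.\<close>
  define D where "D = {k - l |k l. k \<in> supp p \<and> l \<in> supp p \<and> k \<noteq> l} \<union>
    {k - l |k l. k \<in> supp q \<and> l \<in> supp q \<and> k \<noteq> l}"
  have "D \<subseteq> (\<lambda>(k, l). k - l) ` (supp p \<times> supp p) \<union> (\<lambda>(k, l). k - l) ` (supp q \<times> supp q)"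
    by (auto simp: D_def)
  then have "finite D" by (rule finite_subset) simp
  moreover have "0 \<notin> D" by (auto simp: D_def)
  ultimately obtain \<phi> :: "('c \<Rightarrow>\<^sub>0 int) \<Rightarrow> int"
    where add: "\<And>k l. \<phi> (k + l) = \<phi> k + \<phi> l" and nz: "\<And>d. d \<in> D \<Longrightarrow> \<phi> d \<noteq> 0"
    by (rule additive_int_nonzero_on_finite) blast
  have diff: "\<phi> (k - l) = \<phi> k - \<phi> l" for k l
    using add [of "k - l" l] by simp
  have injp: "k = l" if "k \<in> supp p" "l \<in> supp p" "\<phi> k = \<phi> l" for k l
    using nz [of "k - l"] that diff by (auto simp: D_def)
  have injq: "k = l" if "k \<in> supp q" "l \<in> supp q" "\<phi> k = \<phi> l" for k l
    using nz [of "k - l"] that diff by (auto simp: D_def)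
  have "\<exists>k\<in>supp x. \<forall>k'\<in>supp x. \<phi> k' \<le> \<phi> k" if "x \<noteq> 0" for x :: "('c \<Rightarrow>\<^sub>0 int) \<Rightarrow>\<^sub>0 'b"
  proof -
    have "supp x \<noteq> {}" using that by simp
    then have "Max (\<phi> ` supp x) \<in> \<phi> ` supp x" by (intro Max_in) auto
    then show ?thesis by (metis (no_types, lifting) Max_ge finite_imageI finite_keys imageE imageI)
  qed
  then obtain k0 l0 where k0: "k0 \<in> supp p" "\<And>k. k \<in> supp p \<Longrightarrow> \<phi> k \<le> \<phi> k0"
    and l0: "l0 \<in> supp q" "\<And>l. l \<in> supp q \<Longrightarrow> \<phi> l \<le> \<phi> l0"
    using assms by meson
  \<comment> \<open>Both summands are bounded by their maxima under \<open>\<phi>\<close>, so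
    equality of the sums forces equality in each.\<close>
  have lead: "k + l = k0 + l0 \<longleftrightarrow> k = k0 \<and> l = l0" if "k \<in> supp p" "l \<in> supp q" for k l
  proof
    assume "k + l = k0 + l0"
    then have "\<phi> k + \<phi> l = \<phi> k0 + \<phi> l0" by (metis add)
    with k0(2) [OF that(1)] l0(2) [OF that(2)] have "\<phi> k = \<phi> k0" "\<phi> l = \<phi> l0" by auto
    then show "k = k0 \<and> l = l0" using injp injq k0 l0 that by blast
  qed simp
  have "coef (p * q) (k0 + l0) =
      (\<Sum>k\<in>supp p. \<Sum>l\<in>supp q. if k + l = k0 + l0 then coef p k * coef q l else 0)"
    unfolding poly_mapping_mult_expand [of p q]
    by (simp add: lookup_sum lookup_single when_def)
  also have "\<dots> = (\<Sum>k\<in>supp p. if k = k0 then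
      (\<Sum>l\<in>supp q. if l = l0 then coef p k * coef q l else 0) else 0)"
    by (intro sum.cong refl) (auto simp: lead intro!: sum.cong sum.neutral)
  also have "\<dots> = coef p k0 * coef q l0"
    using k0(1) l0(1) by simp
  finally have "coef (p * q) (k0 + l0) \<noteq> 0"
    using k0(1) l0(1) by (simp add: in_keys_iff)
  then show ?thesis by auto
qed

lemma laurent_mult_left_cancel:
  fixes a p q :: "('c \<Rightarrow>\<^sub>0 int) \<Rightarrow>\<^sub>0 'b::{comm_ring, ring_no_zero_divisors}"
  assumes "a * p = a * q" and "a \<noteq> 0"
  shows "p = q"
  using laurent_no_zero_divisors [of a "p - q"] assms by (auto simp: algebra_simps)

lemma laurent_prod_nonzero:
  fixes f :: "'i \<Rightarrow> ('c \<Rightarrow>\<^sub>0 int) \<Rightarrow>\<^sub>0 'b::idom"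
  assumes "\<And>i. i \<in> A \<Longrightarrow> f i \<noteq> 0"
  shows "prod f A \<noteq> 0"
  using assms by (induction A rule: infinite_finite_induct) (auto simp: laurent_no_zero_divisors)

text \<open>The identically zero factors are left out of the three products, so only nonzero
  elements of a ring without zero divisors are multiplied.\<close>

lemma m_den_nonzero: "m_den R r \<noteq> 0"
  unfolding m_den_def by (intro laurent_no_zero_divisors laurent_prod_nonzero) auto

section \<open>Evaluation on the parameter space\<close>

definition eval_mon :: "'x param \<Rightarrow> (('x \<Rightarrow> 'x) set \<Rightarrow>\<^sub>0 int) \<Rightarrow> complex" where
  "eval_mon v k = (\<Prod>c\<in>supp k. of_real (v (SOME s. s \<in> c)) powi coef k c)"

lemma eval_param_eq: "eval_param v p = (\<Sum>k\<in>supp p. coef p k * eval_mon v k)"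
  by (simp add: eval_param_def eval_mon_def)

text \<open>The default 1 off the reflections makes this true for every \<open>s\<close>. That
  matters because \<open>eval_param\<close> picks representatives from arbitrary sets, not only from
  conjugacy classes of reflections.\<close>

lemma param_space_pos: "v \<in> param_space R \<Longrightarrow> 0 < v s"
  by (cases "s \<in> reflections R") (auto simp: param_space_def)

text \<open>Supports may shrink under addition; this allows one finite index set for both summands
  and their sum.\<close>

lemma eval_mon_superset:
  assumes "finite A" and "supp k \<subseteq> A"
  shows "eval_mon v k = (\<Prod>c\<in>A. of_real (v (SOME s. s \<in> c)) powi coef k c)"
  unfolding eval_mon_def
  by (rule prod.mono_neutral_left) (use assms in \<open>auto simp: in_keys_iff\<close>)

lemma eval_mon_add:
  assumes "v \<in> param_space R"
  shows "eval_mon v (k + l) = eval_mon v k * eval_mon v l"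
proof -
  define A where "A = supp k \<union> supp l"
  have A: "finite A" "supp k \<subseteq> A" "supp l \<subseteq> A" "supp (k + l) \<subseteq> A"
    using keys_add [of k l] by (auto simp: A_def)
  \<comment> \<open>Exponents may be negative, so the addition law for integer powers requires a
    nonzero base.\<close>
  have "v s \<noteq> 0" for s using param_space_pos [OF assms, of s] by simp
  then show ?thesis
    by (simp add: eval_mon_superset [OF A(1)] A lookup_add power_int_add prod.distrib)
qed

lemma eval_param_superset:
  assumes "finite A" and "supp p \<subseteq> A"
  shows "eval_param v p = (\<Sum>k\<in>A. coef p k * eval_mon v k)"
  unfolding eval_param_eq
  by (rule sum.mono_neutral_left) (use assms in \<open>auto simp: in_keys_iff\<close>)

lemma eval_param_add: "eval_param v (p + q) = eval_param v p + eval_param v q"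
proof -
  define A where "A = supp p \<union> supp q"
  have A: "finite A" "supp p \<subseteq> A" "supp q \<subseteq> A" "supp (p + q) \<subseteq> A"
    using keys_add [of p q] by (auto simp: A_def)
  show ?thesis
    by (simp add: eval_param_superset [OF A(1)] A lookup_add sum.distrib ring_distribs)
qed

lemma eval_param_sum: "eval_param v (\<Sum>i\<in>I. f i) = (\<Sum>i\<in>I. eval_param v (f i))"
proof (induction I rule: infinite_finite_induct)
  case (insert i I)
  then show ?case by (simp add: eval_param_add)
qed (auto simp: eval_param_eq)

lemma eval_param_single: "eval_param v (sng k c) = c * eval_mon v k"
  by (simp add: eval_param_superset [of "{k}"])

lemma eval_param_mult:
  assumes "v \<in> param_space R"
  shows "eval_param v (p * q) = eval_param v p * eval_param v q"
  unfolding poly_mapping_mult_expand [of p q] eval_param_sum eval_param_single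
    eval_mon_add [OF assms] eval_param_eq [of v p] eval_param_eq [of v q] sum_product
  by (simp add: mult_ac)

lemma continuous_on_eval_param: "continuous_on (param_space R) (\<lambda>v. eval_param v p)"
proof -
  have coord: "continuous_on A (\<lambda>v :: 'x param. v s)" for A :: "'x param set" and s
    by (rule continuous_on_subset [OF continuous_on_product_coordinates]) simp
  \<comment> \<open>Negative powers are continuous only away from zero.\<close>
  have "complex_of_real (v s) \<noteq> 0" if "v \<in> param_space R" for v s
    using param_space_pos [OF that, of s] by simp
  then show ?thesis
    unfolding eval_param_def by (intro continuous_intros coord) auto
qed

section \<open>The function \<open>m\<^sub>b\<close>\<close>

text \<open>Cross-multiplying two representing fractions and cancelling \<open>m_den R r\<close>
  gives \<open>p * q' = p' * q\<close>, which evaluation, being multiplicative, carries over to the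
  values. Hence a single fraction computes \<open>m_value\<close> wherever its denominator does not
  vanish.\<close>

lemma m_value_eq:
  assumes v: "v \<in> param_space R"
    and pq: "p \<in> Lambda R" "q \<in> Lambda R" "p * m_den R r = q * m_num R r" "eval_param v q \<noteq> 0"
  shows "m_value R r v = eval_param v p / eval_param v q"
proof -
  have "y = eval_param v p / eval_param v q"
    if "p' * m_den R r = q' * m_num R r" "eval_param v q' \<noteq> 0"
      "y = eval_param v p' / eval_param v q'" for y p' q'
  proof -
    have "m_den R r * (p * q') = (p * m_den R r) * q'" by (simp only: mult_ac)
    also have "\<dots> = (q' * m_num R r) * q" unfolding pq(3) by (simp only: mult_ac)
    also have "\<dots> = m_den R r * (p' * q)" unfolding that(1) [symmetric] by (simp only: mult_ac)
    finally have "m_den R r * (p * q') = m_den R r * (p' * q)" .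
    then have "p * q' = p' * q"
      using laurent_mult_left_cancel m_den_nonzero by blast
    then have "eval_param v p * eval_param v q' = eval_param v p' * eval_param v q"
      by (metis eval_param_mult [OF v])
    then show ?thesis by (simp add: that(3) frac_eq_eq [OF that(2) pq(4)])
  qed
  then have "(THE y. \<exists>p\<in>Lambda R. \<exists>q\<in>Lambda R. p * m_den R r = q * m_num R r \<and>
      eval_param v q \<noteq> 0 \<and> y = eval_param v p / eval_param v q) = eval_param v p / eval_param v q"
    using pq by (intro the_equality) blast+
  then show ?thesis unfolding m_value_def using pq by auto
qed

lemma continuous_on_m_value:
  assumes "Q \<subseteq> param_space R" and nz: "\<And>v. v \<in> Q \<Longrightarrow> m_value R r v \<noteq> 0"
  shows "continuous_on Q (m_value R r)"
  unfolding continuous_on_def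
proof
  fix v assume v: "v \<in> Q"
  then obtain p q where pq: "p \<in> Lambda R" "q \<in> Lambda R" "p * m_den R r = q * m_num R r"
    "eval_param v q \<noteq> 0"
    \<comment> \<open>A nonzero value rules out the default 0, so a fraction regular at
      \<open>v\<close> exists.\<close>
    using nz [OF v] unfolding m_value_def by (auto split: if_splits)
  have lim: "((\<lambda>v. eval_param v a) \<longlongrightarrow> eval_param v a) (at v within Q)" for a
    using continuous_on_subset [OF continuous_on_eval_param assms(1)] v
    by (auto simp: continuous_on_def)
  have "eventually (\<lambda>u. u \<in> Q) (at v within Q)"
    by (simp add: eventually_at_filter)
  moreover have "eventually (\<lambda>u. eval_param u q \<noteq> 0) (at v within Q)"
    using lim pq(4) by (rule tendsto_imp_eventually_ne)
  \<comment> \<open>The fraction chosen at \<open>v\<close> remains valid at nearby points, because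
    its denominator stays nonzero there.\<close>
  ultimately have "eventually (\<lambda>u. eval_param u p / eval_param u q = m_value R r u) (at v within Q)"
    by eventually_elim (use assms(1) pq in \<open>auto simp: m_value_eq\<close>)
  moreover have "((\<lambda>u. eval_param u p / eval_param u q) \<longlongrightarrow> m_value R r v) (at v within Q)"
    using m_value_eq [OF _ pq] assms(1) v tendsto_divide [OF lim lim pq(4)] by (metis subsetD)
  ultimately show "(m_value R r \<longlongrightarrow> m_value R r v) (at v within Q)"
    by (rule Lim_transform_eventually [rotated])
qed

lemma continuous_on_m\<^sub>b:
  assumes "Q \<subseteq> param_space R" and "\<And>v. v \<in> Q \<Longrightarrow> m\<^sub>b R b v \<noteq> 0"
  shows "continuous_on Q (m\<^sub>b R b)"
proof (cases "\<exists>r. {r'. is_r\<^sub>b R b r'} = {r \<circ> w | w. w \<in> W\<^sub>0 R}")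
  case True
  then have "m\<^sub>b R b = m_value R (SOME r. is_r\<^sub>b R b r)"
    by (intro ext) (simp only: m\<^sub>b_def if_True)
  then show ?thesis using continuous_on_m_value assms by metis
next
  case False
  \<comment> \<open>With the default value 0, the nonvanishing hypothesis leaves only the empty
    \<open>Q\<close>.\<close>
  then have "m\<^sub>b R b v = 0" for v by (simp only: m\<^sub>b_def if_False)
  then show ?thesis using assms(2) by (auto simp: continuous_on_def)
qed

lemma sgn_constant_on_connected:
  fixes f :: "'a::topological_space \<Rightarrow> real"
  assumes "connected C" "continuous_on C f" "\<And>x. x \<in> C \<Longrightarrow> f x \<noteq> 0" "x \<in> C" "y \<in> C"
  shows "sgn (f x) = sgn (f y)"
proof -
  \<comment> \<open>By the intermediate value theorem a negative value at one point forces negative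
    values everywhere on \<open>C\<close>.\<close>
  have "f u < 0" if "u \<in> C" "w \<in> C" "f w < 0" for u w
  proof (rule ccontr)
    assume "\<not> f u < 0"
    then have "{f w..f u} \<subseteq> f ` C"
      using connected_continuous_image [OF assms(2,1)] that
      by (intro connected_contains_Icc) auto
    moreover have "0 \<in> {f w..f u}" using \<open>\<not> f u < 0\<close> \<open>f w < 0\<close> by simp
    ultimately show False using assms(3) by auto
  qed
  then show ?thesis using assms(3-5) by (metis linorder_neqE_linordered_idom sgn_neg sgn_pos)
qed

section \<open>Change of sign\<close>

lemma keys_uminus: "supp (- x) = supp (x :: 'a \<Rightarrow>\<^sub>0 'b::ab_group_add)"
  by (auto simp: in_keys_iff)

lemma scl_uminus_left: "scl (- c) x = - scl c x"
  by (rule poly_mapping_eqI) (simp add: scl_def map.rep_eq when_def)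

lemma uminus_in_cspan: "x \<in> cspan S \<Longrightarrow> - x \<in> cspan S"
proof (induction rule: cspan.induct)
  case (step x y c)
  then have "- x + scl (- c) y \<in> cspan S" by (intro cspan.step)
  then show ?case by (simp add: scl_uminus_left)
qed (simp add: cspan.zero)

lemma uminus_in_ell_null_iff: "- x \<in> ell_null R v \<longleftrightarrow> x \<in> ell_null R v"
  unfolding ell_null_def using uminus_in_cspan [of x] uminus_in_cspan [of "- x"] by auto

lemma ell_neg_ell_neg [simp]: "ell_neg (ell_neg b) = b"
  by (simp add: ell_neg_def image_image)

lemma in_ell_neg_iff: "y \<in> ell_neg b \<longleftrightarrow> - y \<in> b"
proof
  assume "- y \<in> b"
  then have "- (- y) \<in> ell_neg b" unfolding ell_neg_def by (rule imageI)
  then show "y \<in> ell_neg b" by simp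
qed (auto simp: ell_neg_def)

lemma ell_class_uminus: "ell_class R v (- x) = ell_neg (ell_class R v x)"
proof (rule Set.set_eqI)
  fix y
  have "- y - x = - (y - (- x))" by simp
  then show "y \<in> ell_class R v (- x) \<longleftrightarrow> y \<in> ell_neg (ell_class R v x)"
    by (simp only: in_ell_neg_iff ell_class_def mem_Collect_eq uminus_in_ell_null_iff)
qed

lemma uminus_in_int_combs: "x \<in> int_combs P \<Longrightarrow> - x \<in> int_combs P"
  by (auto simp: int_combs_def keys_uminus)

lemma single_in_int_combs: "\<pi> \<in> P \<Longrightarrow> sng \<pi> 1 \<in> int_combs P"
  by (auto simp: int_combs_def lookup_single when_def)

text \<open>Negating the witnessing combination of irreducibles keeps its support, hence the scaling
  limits, and negates the coefficients. This argues on the graph and never uses that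
  \<open>sp\<close> is a function.\<close>

lemma sp_uminus:
  assumes "sp R v (ell_class R v x) b"
  shows "sp R v (ell_class R v (- x)) (ell_neg b)"
proof -
  obtain y where y: "y \<in> int_combs {\<pi>. irreducible_rep R v \<pi>}"
    "ell_class R v x = ell_class R v y"
    "b = ell_class R v_one (\<Sum>\<pi>\<in>supp y. sng (scaling_limit R v \<pi>) (coef y \<pi>))"
    using assms by (auto simp: sp_def)
  have "ell_class R v (- x) = ell_class R v (- y)"
    using y(2) by (simp add: ell_class_uminus)
  moreover have "ell_neg b = ell_class R v_one
      (\<Sum>\<pi>\<in>supp (- y). sng (scaling_limit R v \<pi>) (coef (- y) \<pi>))"
    by (simp add: y(3) keys_uminus single_uminus sum_negf ell_class_uminus)
  ultimately show ?thesis
    unfolding sp_def using uminus_in_int_combs [OF y(1)] by blast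
qed

lemma vchar_uminus: "vchar R (- x) = (\<lambda>w. - vchar R x w)"
  by (rule ext) (simp add: vchar_def keys_uminus sum_negf)

lemma is_dirac_induction_uminus:
  assumes "is_dirac_induction R b v \<xi>"
  shows "is_dirac_induction R (ell_neg b) v (\<lambda>w. - \<xi> w)"
proof -
  let ?I = "int_combs {\<pi>. discrete_series R v \<pi>}"
  have b: "vchar R x = \<xi>" if "x \<in> ?I" "sp R v (ell_class R v x) b" for x
    using assms that unfolding is_dirac_induction_def by blast
  obtain x where x: "x \<in> ?I" "sp R v (ell_class R v x) b" "vchar R x = \<xi>"
    using assms unfolding is_dirac_induction_def by blast
  \<comment> \<open>If \<open>y\<close> has image \<open>ell_neg b\<close>, then \<open>- y\<close>
    has image \<open>b\<close>, so uniqueness for \<open>b\<close> determines the character of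
    \<open>y\<close>.\<close>
  have neg: "vchar R y = (\<lambda>w. - \<xi> w)" if "y \<in> ?I" "sp R v (ell_class R v y) (ell_neg b)" for y
  proof -
    have "vchar R (- y) = \<xi>"
      using b [OF uminus_in_int_combs [OF that(1)]] sp_uminus [OF that(2)] by simp
    then show ?thesis by (auto simp: vchar_uminus)
  qed
  show ?thesis
    unfolding is_dirac_induction_def
  proof (intro equalityI subsetI)
    fix \<psi> assume "\<psi> \<in> {vchar R y |y. y \<in> ?I \<and> sp R v (ell_class R v y) (ell_neg b)}"
    then obtain y where "\<psi> = vchar R y" "y \<in> ?I" "sp R v (ell_class R v y) (ell_neg b)" by blast
    then show "\<psi> \<in> {\<lambda>w. - \<xi> w}" using neg by simp
  next
    fix \<psi> assume "\<psi> \<in> {\<lambda>w. - \<xi> w}"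
    then have "\<psi> = vchar R (- x)" by (simp add: vchar_uminus x(3))
    then show "\<psi> \<in> {vchar R y |y. y \<in> ?I \<and> sp R v (ell_class R v y) (ell_neg b)}"
      using uminus_in_int_combs [OF x(1)] sp_uminus [OF x(2)] by blast
  qed
qed

text \<open>The definition admits both signs, and \<open>ell_neg\<close> is an involution.\<close>

lemma Q_reg_ell_neg: "Q_reg R (ell_neg b) = Q_reg R b"
  by (auto simp: Q_reg_def)

lemma virtual_central_character_uminus:
  assumes "virtual_central_character R v \<xi> t"
  shows "virtual_central_character R v (\<lambda>w. - \<xi> w) t"
proof -
  obtain x where x: "x \<in> int_combs {\<pi>. discrete_series R v \<pi>}" "\<xi> = vchar R x"
    "\<forall>\<pi>\<in>supp x. has_central_character R v \<pi> t"
    using assms unfolding virtual_central_character_def by blast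
  have "(\<lambda>w. - \<xi> w) = vchar R (- x)" by (simp only: x(2) vchar_uminus)
  then show ?thesis
    unfolding virtual_central_character_def
    using uminus_in_int_combs [OF x(1)] x(3) by (intro bexI [of _ "- x"]) (simp_all only: keys_uminus)
qed

text \<open>The central character condition concerns only the constituents of a virtual character,
  and these survive negation.\<close>

lemma is_r\<^sub>b_ell_neg: "is_r\<^sub>b R (ell_neg b) r \<longleftrightarrow> is_r\<^sub>b R b r"
proof -
  have "is_r\<^sub>b R (ell_neg b) r" if r: "is_r\<^sub>b R b r" for b
    unfolding is_r\<^sub>b_def Q_reg_ell_neg
  proof (intro conjI ballI)
    show "generic_residual R r" using r by (simp only: is_r\<^sub>b_def)
    fix v assume "v \<in> Q_reg R b"
    then obtain \<xi> where "is_dirac_induction R b v \<xi>"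
      "virtual_central_character R v \<xi> (\<lambda>x. eval_param v (r x))"
      using r unfolding is_r\<^sub>b_def by blast
    then have "is_dirac_induction R (ell_neg b) v (\<lambda>w. - \<xi> w)"
      "virtual_central_character R v (\<lambda>w. - \<xi> w) (\<lambda>x. eval_param v (r x))"
      by (simp_all only: is_dirac_induction_uminus virtual_central_character_uminus)
    then show "\<exists>\<xi>. is_dirac_induction R (ell_neg b) v \<xi> \<and>
        virtual_central_character R v \<xi> (\<lambda>x. eval_param v (r x))" by blast
  qed
  \<comment> \<open>The implication holds for every class, so its instance at
    \<open>ell_neg b\<close> is the converse.\<close>
  from this [of b] this [of "ell_neg b"] show ?thesis by (auto simp only: ell_neg_ell_neg)
qed

text \<open>\<open>b\<close> enters the definition only through the set of its generic residual
  points.\<close>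

lemma m\<^sub>b_ell_neg: "m\<^sub>b R (ell_neg b) = m\<^sub>b R b"
  by (rule ext) (simp only: m\<^sub>b_def is_r\<^sub>b_ell_neg)

lemma uminus_in_virtual_ds:
  assumes "\<xi> \<in> virtual_ds R v"
  shows "(\<lambda>w. - \<xi> w) \<in> virtual_ds R v"
proof -
  obtain x where x: "x \<in> int_combs {\<pi>. discrete_series R v \<pi>}" "\<xi> = vchar R x"
    using assms unfolding virtual_ds_def by blast
  have "(\<lambda>w. - \<xi> w) = vchar R (- x)" by (simp only: x(2) vchar_uminus)
  then show ?thesis
    unfolding virtual_ds_def using uminus_in_int_combs [OF x(1)] by (rule image_eqI)
qed

text \<open>Additivity is known only on \<open>virtual_ds\<close>, so zero and the negative must
  first be shown to lie there; then \<open>F\<close> vanishes at zero because its value there equals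
  its own double.\<close>

lemma additive_on_virtual_ds_uminus:
  fixes F :: "(('x::ab_group_add \<Rightarrow> 'x) \<Rightarrow> complex) \<Rightarrow> real"
    and R :: "('x, 'y::ab_group_add) root_datum"
  assumes add: "\<forall>\<psi>\<in>virtual_ds R v. \<forall>\<psi>'\<in>virtual_ds R v. F (\<lambda>w. \<psi> w + \<psi>' w) = F \<psi> + F \<psi>'"
    and \<xi>: "\<xi> \<in> virtual_ds R v"
  shows "F (\<lambda>w. - \<xi> w) = - F \<xi>"
proof -
  have "(\<lambda>_. 0) = vchar R 0" by (rule ext) (simp add: vchar_def)
  moreover have "0 \<in> int_combs {\<pi>. discrete_series R v \<pi>}" by (simp add: int_combs_def)
  ultimately have zero: "(\<lambda>_. 0) \<in> virtual_ds R v"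
    unfolding virtual_ds_def by (rule image_eqI)
  have "F (\<lambda>_. 0) = 0" using add [rule_format, OF zero zero] by simp
  moreover have "F (\<lambda>w. \<xi> w + - \<xi> w) = F \<xi> + F (\<lambda>w. - \<xi> w)"
    using add [rule_format, OF \<xi> uminus_in_virtual_ds [OF \<xi>]] .
  ultimately show ?thesis by simp
qed

text \<open>The same linear extension \<open>F\<close> of the Plancherel mass serves both
  characters.\<close>

lemma has_fdeg_uminus:
  assumes "has_fdeg R v \<xi> c"
  shows "has_fdeg R v (\<lambda>w. - \<xi> w) (- c)"
proof -
  obtain F where F: "\<xi> \<in> virtual_ds R v"
    "\<forall>\<psi>\<in>virtual_ds R v. \<forall>\<psi>'\<in>virtual_ds R v. F (\<lambda>w. \<psi> w + \<psi>' w) = F \<psi> + F \<psi>'"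
    "\<forall>\<pi>. discrete_series R v \<pi> \<longrightarrow> has_plancherel_mass R v \<pi> (F (vchar R (sng \<pi> 1)))" "F \<xi> = c"
    using assms unfolding has_fdeg_def by (elim conjE exE)
  have "F (\<lambda>w. - \<xi> w) = - c"
    using additive_on_virtual_ds_uminus [OF F(2,1)] F(4) by simp
  then show ?thesis
    unfolding has_fdeg_def using uminus_in_virtual_ds [OF F(1)] F(2,3) by (intro conjI exI)
qed

lemma is_degree_constant_uminus:
  assumes "is_degree_constant R b d"
  shows "is_degree_constant R (ell_neg b) (- d)"
  unfolding is_degree_constant_def Q_reg_ell_neg m\<^sub>b_ell_neg
proof (intro conjI ballI)
  show "- d \<noteq> 0" using assms by (simp add: is_degree_constant_def)
  fix v assume "v \<in> Q_reg R b"
  then obtain \<xi> c where "is_dirac_induction R b v \<xi>" "has_fdeg R v \<xi> c"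
    "complex_of_real c = of_rat d * m\<^sub>b R b v"
    using assms unfolding is_degree_constant_def by blast
  then have "is_dirac_induction R (ell_neg b) v (\<lambda>w. - \<xi> w) \<and> has_fdeg R v (\<lambda>w. - \<xi> w) (- c) \<and>
      complex_of_real (- c) = of_rat (- d) * m\<^sub>b R b v"
    by (simp add: is_dirac_induction_uminus has_fdeg_uminus of_rat_minus)
  then show "\<exists>\<xi> c. is_dirac_induction R (ell_neg b) v \<xi> \<and> has_fdeg R v \<xi> c \<and>
      complex_of_real c = of_rat (- d) * m\<^sub>b R b v" by blast
qed

section \<open>The sign of Dirac induction\<close>

text \<open>Membership in \<open>Q_reg\<close> supplies a discrete series with image
  \<open>b\<close> or \<open>ell_neg b\<close>, and uniqueness of Dirac induction makes its
  character plus or minus \<open>\<xi>\<close>. Its formal degree is positive, so that sign can only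
  be the sign of \<open>c\<close>.\<close>

lemma is_dirac_sign_iff_sgn_fdeg:
  assumes v: "v \<in> Q_reg R b" and ind: "is_dirac_induction R b v \<xi>" and deg: "has_fdeg R v \<xi> c"
  shows "c \<noteq> 0" and "is_dirac_sign R b v e \<longleftrightarrow> of_int e = sgn c"
proof -
  obtain F where F: "\<xi> \<in> virtual_ds R v"
    "\<forall>\<psi>\<in>virtual_ds R v. \<forall>\<psi>'\<in>virtual_ds R v. F (\<lambda>w. \<psi> w + \<psi>' w) = F \<psi> + F \<psi>'"
    "\<And>\<pi>. discrete_series R v \<pi> \<Longrightarrow> 0 < F (vchar R (sng \<pi> 1))" "F \<xi> = c"
    using deg unfolding has_fdeg_def has_plancherel_mass_def by blast
  have F_neg: "F (\<lambda>w. - \<xi> w) = - c"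
    using additive_on_virtual_ds_uminus [OF F(2,1)] F(4) by simp
  \<comment> \<open>By additivity \<open>F\<close> takes the value \<open>e' * c\<close> at this
    character, and that value is a Plancherel mass.\<close>
  have sign: "of_int e' = sgn c"
    if "e' \<in> {1, -1}" "discrete_series R v \<pi>" "(\<lambda>w. of_int e' * \<xi> w) = vchar R (sng \<pi> 1)" for e' \<pi>
    using that F(3) [OF that(2)] F_neg F(4) by (auto simp flip: that(3))
  obtain \<pi> where \<pi>: "discrete_series R v \<pi>"
    "sp R v (ell_class R v (sng \<pi> 1)) b \<or> sp R v (ell_class R v (sng \<pi> 1)) (ell_neg b)"
    using v by (auto simp: Q_reg_def)
  have "\<exists>e'\<in>{1, -1}. (\<lambda>w. of_int e' * \<xi> w) = vchar R (sng \<pi> 1)"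
  proof -
    let ?I = "int_combs {\<pi>. discrete_series R v \<pi>}"
    have s: "sng \<pi> 1 \<in> ?I" using \<pi>(1) by (simp add: single_in_int_combs)
    have uniq: "vchar R x = \<xi>'"
      if "is_dirac_induction R b' v \<xi>'" "x \<in> ?I" "sp R v (ell_class R v x) b'" for x b' \<xi>'
      using that unfolding is_dirac_induction_def by blast
    \<comment> \<open>In the second case the uniqueness used is that for \<open>ell_neg b\<close>,
      whose Dirac induction is the negative of \<open>\<xi>\<close>.\<close>
    from \<pi>(2) show ?thesis
      using uniq [OF ind s] uniq [OF is_dirac_induction_uminus [OF ind] s] by auto
  qed
  then obtain e' where e': "e' \<in> {1, -1}" "(\<lambda>w. of_int e' * \<xi> w) = vchar R (sng \<pi> 1)"
    by blast
  note sgn_e' = sign [OF e'(1) \<pi>(1) e'(2)]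
  then show "c \<noteq> 0" using e'(1) by auto
  have "is_dirac_sign R b v e'"
    unfolding is_dirac_sign_def using e' \<pi>(1) ind by blast
  moreover have "of_int e = sgn c" if e: "is_dirac_sign R b v e"
  proof -
    obtain \<xi>' \<pi>' where "e \<in> {1, -1}" "is_dirac_induction R b v \<xi>'" "discrete_series R v \<pi>'"
      "(\<lambda>w. of_int e * \<xi>' w) = vchar R (sng \<pi>' 1)"
      using e unfolding is_dirac_sign_def by blast
    moreover from this ind have "\<xi>' = \<xi>" by (simp add: is_dirac_induction_def)
    ultimately show ?thesis using sign by blast
  qed
  \<comment> \<open>For the converse, an \<open>e\<close> with value \<open>sgn c\<close> must be
    the sign \<open>e'\<close> already found.\<close>
  ultimately show "is_dirac_sign R b v e \<longleftrightarrow> of_int e = sgn c"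
    using sgn_e' by (metis of_int_eq_iff)
qed

text \<open>Here \<open>m\<^sub>b\<close> is the real formal degree divided by a positive rational,
  so it inherits realness, nonvanishing and sign from that degree.\<close>

lemma m\<^sub>b_real_nonzero_sign:
  assumes "is_degree_constant R b d" and "d > 0" and v: "v \<in> Q_reg R b"
  shows "m\<^sub>b R b v = of_real (Re (m\<^sub>b R b v))" and "Re (m\<^sub>b R b v) \<noteq> 0"
    and "is_dirac_sign R b v e \<longleftrightarrow> of_int e = sgn (Re (m\<^sub>b R b v))"
proof -
  obtain \<xi> c where \<xi>: "is_dirac_induction R b v \<xi>" "has_fdeg R v \<xi> c"
    "complex_of_real c = of_rat d * m\<^sub>b R b v"
    using assms unfolding is_degree_constant_def by blast
  have d: "complex_of_rat d = of_real (of_rat d)"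
    by (cases d) (simp add: of_rat_rat)
  have d_pos: "0 < real_of_rat d" using \<open>d > 0\<close> by simp
  have "m\<^sub>b R b v = of_real (c / of_rat d)"
    using \<xi>(3) d_pos unfolding d by (simp add: field_simps)
  then have "Re (m\<^sub>b R b v) = c / of_rat d" "m\<^sub>b R b v = of_real (Re (m\<^sub>b R b v))"
    by simp_all
  then show "m\<^sub>b R b v = of_real (Re (m\<^sub>b R b v))" "Re (m\<^sub>b R b v) \<noteq> 0"
    "is_dirac_sign R b v e \<longleftrightarrow> of_int e = sgn (Re (m\<^sub>b R b v))"
    using is_dirac_sign_iff_sgn_fdeg [OF v \<xi>(1,2)] d_pos by (simp_all add: sgn_divide)
qed

lemma dirac_sign_eq_sgn_m\<^sub>b:
  assumes deg: "is_degree_constant R b d" "d > 0"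
    and C: "C \<in> components (Q_reg R b)" and v: "v \<in> C"
  shows "complex_of_int (dirac_sign R b C) = sgn (m\<^sub>b R b v)"
proof -
  let ?f = "\<lambda>v. Re (m\<^sub>b R b v)"
  note m = m\<^sub>b_real_nonzero_sign [OF deg]
  have sub: "C \<subseteq> Q_reg R b" using C by (rule in_components_subset)
  then have "C \<subseteq> param_space R" by (auto simp: Q_reg_def)
  moreover have "m\<^sub>b R b u \<noteq> 0" if "u \<in> C" for u
    using m(2) [of u] that sub by force
  ultimately have "continuous_on C (m\<^sub>b R b)" by (rule continuous_on_m\<^sub>b)
  then have "continuous_on C ?f" by (intro continuous_intros)
  then have const: "sgn (?f u) = sgn (?f v)" if "u \<in> C" for u
    using sgn_constant_on_connected [OF in_components_connected [OF C], of ?f u v]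
      m(2) [OF subsetD [OF sub]] that v by blast
  define e :: int where "e = (if ?f v > 0 then 1 else -1)"
  have e: "of_int e = sgn (?f v)" using m(2) [of v] sub v by (auto simp: e_def sgn_if)
  have "dirac_sign R b C = e"
    unfolding dirac_sign_def
  proof (rule the_equality)
    show "\<forall>u\<in>C. is_dirac_sign R b u e" using m(3) sub const e by auto
    \<comment> \<open>The component contains \<open>v\<close>, so uniqueness of the sign at this one
      point suffices.\<close>
    fix e' assume "\<forall>u\<in>C. is_dirac_sign R b u e'"
    then have "real_of_int e' = of_int e" using m(3) [of v] sub v e by auto
    then show "e' = e" by simp
  qed
  then have "complex_of_int (dirac_sign R b C) = of_real (sgn (?f v))"
    by (simp flip: e)
  \<comment> \<open>The complex \<open>sgn\<close> is division by the modulus; it agrees with the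
    real sign because \<open>m\<^sub>b\<close> is real here.\<close>
  also have "\<dots> = sgn (complex_of_real (?f v))" by (simp add: sgn_of_real)
  also have "\<dots> = sgn (m\<^sub>b R b v)" using m(1) [of v] sub v by auto
  finally show ?thesis .
qed

theorem corollary3p19:
  fixes R :: "('x::ab_group_add, 'y::ab_group_add) root_datum"
    and B :: "'x ell_elt set"
  assumes "semisimple_based_root_datum R"
    and "orthonormal_basis R (massive_lattice R) B"
    and "\<And>b. b \<in> B \<Longrightarrow> \<exists>!d. is_degree_constant R b d"
  shows "\<forall>b\<in>B.
    (\<exists>!b'. b' \<in> {b, ell_neg b} \<and> d\<^sub>b R b' > 0) \<and>
    (\<forall>b'\<in>{b, ell_neg b}. d\<^sub>b R b' > 0 \<longrightarrow>
       (\<forall>C\<in>components (Q_reg R b'). \<forall>v\<in>C.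
          complex_of_int (dirac_sign R b' C) = sgn (m\<^sub>b R b' v)))"
proof
  fix b assume "b \<in> B"
  then obtain d where d: "is_degree_constant R b d" "\<And>d'. is_degree_constant R b d' \<Longrightarrow> d' = d"
    using assms(3) by blast
  have neg: "is_degree_constant R (ell_neg b) (- d)"
    using is_degree_constant_uminus [OF d(1)] .
  \<comment> \<open>Negation carries uniqueness from \<open>b\<close> over to
    \<open>ell_neg b\<close>, so the description defining \<open>d\<^sub>b\<close> is also
    meaningful there.\<close>
  have neg_uniq: "d' = - d" if "is_degree_constant R (ell_neg b) d'" for d'
    using d(2) [of "- d'"] is_degree_constant_uminus [OF that] by simp
  have db: "d\<^sub>b R b = d" unfolding d\<^sub>b_def using d by (rule the_equality)
  have db_neg: "d\<^sub>b R (ell_neg b) = - d" unfolding d\<^sub>b_def using neg neg_uniq by (rule the_equality)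
  have "d \<noteq> 0" using d(1) by (simp add: is_degree_constant_def)
  then consider "d > 0" | "- d > 0" by linarith
  then have "\<exists>!b'. b' \<in> {b, ell_neg b} \<and> d\<^sub>b R b' > 0"
  proof cases
    case 1
    show ?thesis
    proof (rule ex1I)
      show "b \<in> {b, ell_neg b} \<and> d\<^sub>b R b > 0" using 1 by (simp add: db)
      fix b' assume b': "b' \<in> {b, ell_neg b} \<and> d\<^sub>b R b' > 0"
      \<comment> \<open>The constant of \<open>ell_neg b\<close> is \<open>- d\<close>, which is
        negative in this case.\<close>
      have "b' \<noteq> ell_neg b" using b' 1 db_neg by force
      with b' show "b' = b" by blast
    qed
  next
    case 2
    show ?thesis
    proof (rule ex1I)
      show "ell_neg b \<in> {b, ell_neg b} \<and> d\<^sub>b R (ell_neg b) > 0" using 2 by (simp add: db_neg)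
      fix b' assume b': "b' \<in> {b, ell_neg b} \<and> d\<^sub>b R b' > 0"
      have "b' \<noteq> b" using b' 2 db by force
      with b' show "b' = ell_neg b" by blast
    qed
  qed
  moreover have "is_degree_constant R b' (d\<^sub>b R b')" if "b' \<in> {b, ell_neg b}" for b'
    using that d(1) neg by (elim insertE) (simp_all add: db db_neg)
  then have "\<forall>b'\<in>{b, ell_neg b}. d\<^sub>b R b' > 0 \<longrightarrow>
       (\<forall>C\<in>components (Q_reg R b'). \<forall>v\<in>C.
          complex_of_int (dirac_sign R b' C) = sgn (m\<^sub>b R b' v))"
    by (intro ballI impI) (rule dirac_sign_eq_sgn_m\<^sub>b)
  ultimately show "(\<exists>!b'. b' \<in> {b, ell_neg b} \<and> d\<^sub>b R b' > 0) \<and>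
    (\<forall>b'\<in>{b, ell_neg b}. d\<^sub>b R b' > 0 \<longrightarrow>
       (\<forall>C\<in>components (Q_reg R b'). \<forall>v\<in>C.
          complex_of_int (dirac_sign R b' C) = sgn (m\<^sub>b R b' v)))" ..
qed

end
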